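(* There exist constants $p>0$ and $C<\infty$ such that for every integer $n\ge 1$, $$\operatorname{Fav}(\mathcal G_n)\le \frac{C}{n^{p}}.$$
   Context: For $n\ge 1$ and $\alpha=(\alpha_1,\dots,\alpha_n)\in\{-1,0,1\}^n$ let $z_\alpha=\sum_{k=1}^n 3^{-k}e^{i\pi(\frac12+\frac23\alpha_k)}\in\mathbb C$, and let $\mathcal G_n=\bigcup_{\alpha\in\{-1,0,1\}^n}B(z_\alpha,3^{-n})$, where $B(w,r)=\{z\in\mathbb C:|z-w|<r\}$ (a union of $3^n$ discs approximating the Sierpinski gasket). For $\theta\in[0,\pi)$ let $\operatorname{proj}_\theta:\mathbb C\to\mathbb R$, $\operatorname{proj}_\theta(w)=\operatorname{Re}(we^{-i\theta})$, be orthogonal projection onto the line in direction $e^{i\theta}$. The Favard length of a bounded set $A\subset\mathbb C$ is $\operatorname{Fav}(A)=\frac1\pi\int_0^\pi|\operatorname{proj}_\theta(A)|\,d\theta$, with $|\cdot|$ Lebesgue measure on $\mathbb R$. *)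

theory Defs
  imports "HOL-Analysis.Analysis" "HOL-Library.FuncSet"
begin

definition zc :: "nat \<Rightarrow> (nat \<Rightarrow> int) \<Rightarrow> complex" where
  "zc n \<alpha> = (\<Sum>k=1..n. (1/3) ^ k * cis (pi * (1/2 + 2/3 * of_int (\<alpha> k))))"

definition gasket_approx :: "nat \<Rightarrow> complex set" where
  "gasket_approx n = (\<Union>\<alpha> \<in> {1..n} \<rightarrow>\<^sub>E {-1, 0, 1::int}. ball (zc n \<alpha>) ((1/3) ^ n))"

definition proj :: "real \<Rightarrow> complex \<Rightarrow> real" where
  "proj \<theta> w = Re (w * cis (- \<theta>))"

definition Fav :: "complex set \<Rightarrow> real" where
  "Fav A = (1 / pi) * integral {0..pi} (\<lambda>\<theta>. measure lebesgue (proj \<theta> ` A))"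

end

(*
For a fixed direction the projected discs are intervals coded by ternary words, centred at the points
sum_k 3^(-k) d(a_k), where d lists the projections of the three unit vectors (so their sum is 0).
Fix a threshold K and a depth N, call a word heavy if its interval is close to at least K intervals of
the same generation, and let q be the proportion of words of length N having a prefix close to a heavy
word.

If q is at least 1/(24 K), a Vitali covering shows that these words project into a set of length
O(q/K); iterating the construction on the other words brings the total length down to O(1/K).

If q < 1/(24 K), self-similarity bounds the number of close pairs of words of every length n <= N by
2K 3^n, so the Fourier transform of the n-th measure has energy O(K) on [0, 3^n]. That transform is the
Riesz-type product of phi(3^(-k) y), phi(y) = (e^(i d_1 y) + e^(i d_2 y) + e^(i d_3 y)) / 3. Because
d_1 + d_2 + d_3 = 0, phi(3y) is close to 1 where phi(y) is close to 0, so m consecutive factors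
multiply to at least 18^(-m) rho as soon as |phi| >= rho on [0, 3^m]. Hence each block
[3^(im), 3^((i+1)m)] carries a definite amount of energy, and exponentially many (in m) blocks contradict
the bound O(K) with K of order 3^m.

The condition |phi| >= rho on [0, 3^m] fails only if 3 d_j y / (2 pi) is nearly integral for all j, i.e.
if the direction is very close to one of O(9^m) lattice directions; for rho = 81^(-m) these directions
have measure O(3^(-m)).
*)
theory Submission
  imports Defs
begin

section \<open>Elementary estimates\<close>

text \<open>A weak Jordan inequality. Up to pi/3 the derivative of sin t - t/2 is nonnegative; from
  there to pi/2 the sine is at least sqrt 3 / 2, which exceeds pi/4.\<close>

lemma abs_sin_ge_half:
  fixes x :: real
  assumes "\<bar>x\<bar> \<le> pi / 2"
  shows "\<bar>x\<bar> / 2 \<le> \<bar>sin x\<bar>"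
proof -
  have *: "y / 2 \<le> sin y" if y: "0 \<le> y" "y \<le> pi / 2" for y :: real
  proof (cases "y \<le> pi / 3")
    case True
    have "(\<lambda>t. sin t - t / 2) 0 \<le> (\<lambda>t. sin t - t / 2) y"
    proof (rule DERIV_nonneg_imp_nondecreasing[OF y(1)])
      fix t assume t: "0 \<le> t" "t \<le> y"
      have "cos (pi / 3) \<le> cos t" using t True by (intro cos_monotone_0_pi_le) auto
      then show "\<exists>z. ((\<lambda>t. sin t - t / 2) has_real_derivative z) (at t) \<and> 0 \<le> z"
        by (intro exI[of _ "cos t - 1 / 2"]) (auto intro!: derivative_eq_intros simp: cos_60)
    qed
    then show ?thesis by simp
  next
    case False
    have "sin (pi / 3) \<le> sin y" using False y by (intro sin_monotone_2pi_le) auto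
    moreover have "(1.7::real) \<le> sqrt 3" by (rule real_le_rsqrt) (simp add: power2_eq_square)
    moreover have "pi < 3.2" using pi_approx by simp
    ultimately show ?thesis using y by (simp add: sin_60)
  qed
  show ?thesis using *[of x] *[of "-x"] assms by (cases "x \<ge> 0") auto
qed

text \<open>Subtracting the nearest integer from \<open>t\<close> changes sin (pi t) at most in
  sign. This turns a small sine into closeness to an integer.\<close>

lemma abs_sin_ge_round: "\<bar>t - of_int (round t)\<bar> \<le> \<bar>sin (pi * t)\<bar>"
proof -
  define u where "u = t - of_int (round t)"
  have u: "\<bar>u\<bar> \<le> 1 / 2" unfolding u_def using of_int_round_abs_le[of t] by (simp add: abs_minus_commute)
  have s0: "sin (pi * of_int (round t)) = 0" by (auto simp: sin_zero_iff_int2 mult.commute)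
  have "sin (pi * t) = sin (pi * u + pi * of_int (round t))"
    by (simp add: u_def right_diff_distrib)
  also have "\<dots> = sin (pi * u) * cos (pi * of_int (round t))"
    using s0 by (simp add: sin_add)
  finally have "sin (pi * t) = sin (pi * u) * cos (pi * of_int (round t))" .
  moreover have "\<bar>cos (pi * of_int (round t))\<bar> = 1"
    using sin_cos_squared_add[of "pi * of_int (round t)"] s0 by (simp add: abs_square_eq_1)
  ultimately have "\<bar>sin (pi * t)\<bar> = \<bar>sin (pi * u)\<bar>" by (simp add: abs_mult)
  moreover have "\<bar>pi * u\<bar> / 2 \<le> \<bar>sin (pi * u)\<bar>"
    using u pi_gt_zero by (intro abs_sin_ge_half) (simp add: abs_mult)
  moreover have "\<bar>u\<bar> \<le> \<bar>pi * u\<bar> / 2"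
    using mult_right_mono[OF pi_ge_two, of "\<bar>u\<bar>"] by (simp add: abs_mult)
  ultimately show ?thesis by (simp add: u_def)
qed

lemma one_minus_cos_le: "1 - cos (x::real) \<le> x\<^sup>2 / 2"
proof -
  have "cos x = 1 - 2 * (sin (x / 2))\<^sup>2" using cos_double_sin[of "x / 2"] by simp
  moreover have "(sin (x / 2))\<^sup>2 \<le> (x / 2)\<^sup>2"
    using abs_sin_x_le_abs_x[of "x / 2"] abs_le_square_iff by blast
  ultimately show ?thesis by (simp add: power2_eq_square)
qed

lemma one_minus_cos_triple_le: "1 - cos (3 * t) \<le> 9 * (1 - cos (t::real))"
proof -
  have "1 - cos (3 * t) = (1 - cos t) * (1 + 2 * cos t)\<^sup>2"
    using cos_treble_cos[of t] by (simp add: power2_eq_square power3_eq_cube algebra_simps)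
  also have "\<dots> \<le> (1 - cos t) * 9"
  proof (rule mult_left_mono)
    have "\<bar>1 + 2 * cos t\<bar> \<le> 3" using abs_cos_le_one[of t] by linarith
    then have "\<bar>1 + 2 * cos t\<bar>\<^sup>2 \<le> 3\<^sup>2" by (rule power_mono) simp
    then show "(1 + 2 * cos t)\<^sup>2 \<le> 9" by simp
  qed simp
  finally show ?thesis by simp
qed

lemma cos_ge: "\<bar>x\<bar> \<le> c \<Longrightarrow> 1 - c\<^sup>2 / 2 \<le> cos (x::real)"
  using one_minus_cos_le[of x] abs_le_square_iff[of x c] by (simp add: abs_le_iff)

lemma cmod_cis_minus_one: "cmod (cis s - 1) = 2 * \<bar>sin (s / 2)\<bar>"
proof (rule power2_eq_imp_eq)
  have "(cmod (cis s - 1))\<^sup>2 = 2 - 2 * cos s"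
    unfolding cmod_power2 using sin_cos_squared_add[of s] by (simp add: power2_eq_square algebra_simps)
  also have "\<dots> = 4 * (sin (s / 2))\<^sup>2" using cos_double_sin[of "s / 2"] by simp
  finally show "(cmod (cis s - 1))\<^sup>2 = (2 * \<bar>sin (s / 2)\<bar>)\<^sup>2" by (simp add: power_mult_distrib)
qed simp_all

text \<open>With s = a + b + c, the elementary symmetric functions of a, b, c are s, the conjugate
  of s, and 1. So a is a root of X^3 - s X^2 + cnj s X - 1, and a^3 - 1 is a sum of two terms of
  modulus |s|.\<close>

lemma cmod_cube_minus_one_le:
  assumes abc: "a * b * c = 1" and n: "cmod a = 1" "cmod b = 1" "cmod c = 1"
  shows "cmod (a ^ 3 - 1) \<le> 2 * cmod (a + b + c)"
proof -
  have cnj1: "cnj z = w" if "z * w = 1" "cmod z = 1" for z w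
  proof -
    have "z * cnj z = 1" using that(2) by (simp add: complex_mult_cnj cmod_power2[symmetric] complex_norm_square[symmetric])
    then show ?thesis using that(1) by (metis mult_cancel_left mult_zero_left zero_neq_one)
  qed
  have "cnj a = b * c" "cnj b = c * a" "cnj c = a * b"
    using abc n by (auto intro!: cnj1 simp: mult_ac)
  then have "cnj (a + b + c) = b * c + c * a + a * b" by simp
  then have "a ^ 3 - 1 = (a + b + c) * a\<^sup>2 - cnj (a + b + c) * a"
    using abc by (simp add: power2_eq_square power3_eq_cube) algebra
  then have "cmod (a ^ 3 - 1) \<le> cmod ((a + b + c) * a\<^sup>2) + cmod (cnj (a + b + c) * a)"
    by (metis norm_triangle_ineq4)
  then show ?thesis by (simp add: norm_mult norm_power n del: complex_cnj_add)
qed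

lemma measure_ball_real: "r \<ge> 0 \<Longrightarrow> measure lebesgue (ball (x::real) r) = 2 * r"
  by (simp add: ball_eq_greaterThanLessThan)

text \<open>No measurability of \<open>f\<close> is assumed: the integral of a non-integrable
  function is 0 by convention, and the right-hand side is nonnegative.\<close>

lemma integral_le_off_exceptional:
  fixes f :: "real \<Rightarrow> real"
  assumes E: "E \<in> lmeasurable" and "0 \<le> c" "0 \<le> B" "a \<le> b"
    and off: "\<And>x. a \<le> x \<Longrightarrow> x \<le> b \<Longrightarrow> x \<notin> E \<Longrightarrow> f x \<le> c"
    and on: "\<And>x. a \<le> x \<Longrightarrow> x \<le> b \<Longrightarrow> f x \<le> B"
  shows "integral {a..b} f \<le> c * (b - a) + B * measure lebesgue E"
proof (cases "f integrable_on {a..b}")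
  case True
  have I: "indicat_real E integrable_on {a..b}"
    using E by (intro integrable_on_indicator[THEN iffD2] fmeasurable.Int) auto
  have "integral {a..b} f \<le> integral {a..b} (\<lambda>x. c + B * indicat_real E x)"
    using True I assms by (intro integral_le integrable_add integrable_on_mult_right)
      (auto split: split_indicator intro: order_trans[OF on])
  also have "\<dots> = c * (b - a) + B * integral {a..b} (indicat_real E)"
    using I \<open>a \<le> b\<close> by (subst integral_add) (auto intro: integrable_on_mult_right)
  also have "integral {a..b} (indicat_real E) = measure lebesgue (E \<inter> {a..b})"
    using E by (intro integral_indicator fmeasurable.Int) auto
  also have "\<dots> \<le> measure lebesgue E"
    using E by (intro measure_mono_fmeasurable) (auto simp: fmeasurableD)
  finally show ?thesis using \<open>0 \<le> B\<close> by (simp add: mult_left_mono)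
next
  case False
  then show ?thesis using assms by (simp add: not_integrable_integral)
qed

section \<open>Counting close pairs\<close>

lemma card_pairs_eq:
  assumes "finite A"
  shows "card {(a, b) \<in> A \<times> A. P a b} = (\<Sum>a\<in>A. card {b \<in> A. P a b})"
proof -
  have "{(a, b) \<in> A \<times> A. P a b} = (SIGMA a:A. {b \<in> A. P a b})" by auto
  then show ?thesis using assms by simp
qed

text \<open>Pairs are sorted by the difference of their bin indices, not by their distance, so that
  the counts become the autocorrelation of the histogram of \<open>x\<close> with bin width
  \<open>h\<close>.\<close>

definition bin_pairs :: "real \<Rightarrow> ('a \<Rightarrow> real) \<Rightarrow> 'a set \<Rightarrow> int \<Rightarrow> ('a \<times> 'a) set" where
  "bin_pairs h x A k = {(a, b) \<in> A \<times> A. \<lfloor>x b / h\<rfloor> - \<lfloor>x a / h\<rfloor> = k}"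

lemma finite_bin_pairs: "finite A \<Longrightarrow> finite (bin_pairs h x A k)"
  unfolding bin_pairs_def by (rule finite_subset[of _ "A \<times> A"]) auto

text \<open>An autocorrelation is largest at shift 0: apply 2 u v <= u^2 + v^2 to the bin counts
  \<open>c\<close>.\<close>

lemma card_bin_pairs_le:
  assumes "finite A"
  shows "card (bin_pairs h x A k) \<le> card (bin_pairs h x A 0)"
proof -
  define \<beta> where "\<beta> a = \<lfloor>x a / h\<rfloor>" for a
  define c where "c i = card {a \<in> A. \<beta> a = i}" for i
  define J where "J = \<beta> ` A"
  have fJ: "finite J" using assms by (simp add: J_def)
  have c0: "c i = 0" if "i \<notin> J" for i
    using that by (auto simp: c_def J_def card_eq_0_iff)
  have T: "card (bin_pairs h x A l) = (\<Sum>i\<in>J. c i * c (i + l))" for l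
  proof -
    have "bin_pairs h x A l = (\<Union>i\<in>J. {a \<in> A. \<beta> a = i} \<times> {a \<in> A. \<beta> a = i + l})"
      by (auto simp: bin_pairs_def J_def \<beta>_def)
    then show ?thesis using assms fJ
      by (simp, subst card_UN_disjoint) (auto simp: c_def card_cartesian_product)
  qed
  have "2 * (\<Sum>i\<in>J. c i * c (i + k)) \<le> (\<Sum>i\<in>J. c i * c i + c (i + k) * c (i + k))"
    unfolding sum_distrib_left
  proof (rule sum_mono)
    fix i
    have "2 * (real (c i) * real (c (i + k))) \<le> real (c i) * real (c i) + real (c (i + k)) * real (c (i + k))"
      using sum_squares_bound[of "real (c i)" "real (c (i + k))"] by (simp add: power2_eq_square)
    then have "real (2 * (c i * c (i + k))) \<le> real (c i * c i + c (i + k) * c (i + k))"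
      by simp
    then show "2 * (c i * c (i + k)) \<le> c i * c i + c (i + k) * c (i + k)"
      by (simp only: of_nat_le_iff)
  qed
  also have "\<dots> = (\<Sum>i\<in>J. c i * c i) + (\<Sum>i\<in>(\<lambda>i. i + k) ` J. c i * c i)"
    by (simp add: sum.distrib sum.reindex inj_on_def)
  \<comment> \<open>Shifted bins outside \<open>J\<close> are empty, so the shifted sum of squares
    is at most the original one.\<close>
  also have "(\<Sum>i\<in>(\<lambda>i. i + k) ` J. c i * c i) = (\<Sum>i\<in>(\<lambda>i. i + k) ` J \<inter> J. c i * c i)"
    using fJ c0 by (intro sum.mono_neutral_right) auto
  also have "\<dots> \<le> (\<Sum>i\<in>J. c i * c i)"
    using fJ by (intro sum_mono2) auto
  finally show ?thesis by (simp add: T)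
qed

lemma bin_pairs_0_subset:
  assumes "h > 0"
  shows "bin_pairs h x A 0 \<subseteq> {(a, b) \<in> A \<times> A. \<bar>x a - x b\<bar> \<le> h}"
proof (clarsimp simp: bin_pairs_def)
  fix a b assume ab: "\<lfloor>x b / h\<rfloor> = \<lfloor>x a / h\<rfloor>"
  then have "\<bar>x a / h - x b / h\<bar> \<le> 1" by linarith
  also have "x a / h - x b / h = (x a - x b) / h" by (simp add: diff_divide_distrib)
  finally show "\<bar>x a - x b\<bar> \<le> h" using assms by (simp add: abs_divide)
qed

text \<open>A pair that is close after translation by \<open>t\<close> has one of only four possible
  differences of bin indices. Each of these classes is no larger than the class of difference 0,
  whose pairs are close without translation.\<close>

lemma card_shifted_pairs_le:
  fixes x :: "'a \<Rightarrow> real"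
  assumes "finite A" "h > 0"
  shows "card {(a, b) \<in> A \<times> A. \<bar>x a - x b + t\<bar> \<le> h} \<le> 4 * card {(a, b) \<in> A \<times> A. \<bar>x a - x b\<bar> \<le> h}"
proof -
  define m where "m = \<lfloor>t / h\<rfloor>"
  have "{(a, b) \<in> A \<times> A. \<bar>x a - x b + t\<bar> \<le> h} \<subseteq> (\<Union>k\<in>{m-1..m+2}. bin_pairs h x A k)"
  proof clarify
    fix a b assume ab: "a \<in> A" "b \<in> A" "\<bar>x a - x b + t\<bar> \<le> h"
    have "\<bar>x a / h - x b / h + t / h\<bar> = \<bar>x a - x b + t\<bar> / h"
    proof -
      have "x a / h - x b / h + t / h = (x a - x b + t) / h" by (simp add: add_divide_distrib diff_divide_distrib)
      then show ?thesis using assms by (simp add: abs_divide)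
    qed
    also have "\<dots> \<le> 1" using ab assms by simp
    finally have "\<bar>x a / h - x b / h + t / h\<bar> \<le> 1" .
    then have "\<lfloor>x b / h\<rfloor> - \<lfloor>x a / h\<rfloor> \<in> {m-1..m+2}"
      unfolding m_def by (simp, linarith)
    then show "(a, b) \<in> (\<Union>k\<in>{m-1..m+2}. bin_pairs h x A k)"
      using ab by (auto simp: bin_pairs_def)
  qed
  then have "card {(a, b) \<in> A \<times> A. \<bar>x a - x b + t\<bar> \<le> h} \<le> card (\<Union>k\<in>{m-1..m+2}. bin_pairs h x A k)"
    using assms by (intro card_mono) (auto simp: finite_bin_pairs)
  also have "\<dots> \<le> (\<Sum>k\<in>{m-1..m+2}. card (bin_pairs h x A k))"
    by (rule card_UN_le) auto
  also have "\<dots> \<le> (\<Sum>k\<in>{m-1..m+2}. card (bin_pairs h x A 0))"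
    by (intro sum_mono card_bin_pairs_le assms)
  also have "\<dots> = 4 * card (bin_pairs h x A 0)" by simp
  finally have le: "card {(a, b) \<in> A \<times> A. \<bar>x a - x b + t\<bar> \<le> h} \<le> 4 * card (bin_pairs h x A 0)" .
  have "bin_pairs h x A 0 \<subseteq> {(a, b) \<in> A \<times> A. \<bar>x a - x b\<bar> \<le> h}"
    using assms(2) by (rule bin_pairs_0_subset)
  then have "card (bin_pairs h x A 0) \<le> card {(a, b) \<in> A \<times> A. \<bar>x a - x b\<bar> \<le> h}"
    using assms by (intro card_mono[OF finite_subset[of _ "A \<times> A"]]) auto
  then show ?thesis using le by linarith
qed

section \<open>The Fejer kernel\<close>

text \<open>Closed form of the integral of (1 - y/R) cos (y t) over [0, R]; R/2 is the limit at t =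
  0. The triangular weight is there to make this kernel nonnegative.\<close>

definition fejer :: "real \<Rightarrow> real \<Rightarrow> real" where
  "fejer R t = (if t = 0 then R / 2 else (1 - cos (R * t)) / (R * t\<^sup>2))"

lemma has_integral_fejer:
  assumes "R > 0"
  shows "((\<lambda>y. (1 - y / R) * cos (y * t)) has_integral fejer R t) {0..R}"
proof (cases "t = 0")
  case True
  have "((\<lambda>y. 1 - y / R) has_integral ((R - R\<^sup>2 / (2 * R)) - (0 - 0\<^sup>2 / (2 * R)))) {0..R}"
    using assms by (intro fundamental_theorem_of_calculus)
      (auto intro!: derivative_eq_intros simp: has_real_derivative_iff_has_vector_derivative[symmetric])
  then show ?thesis using True assms by (simp add: fejer_def power2_eq_square)
next
  case False
  define G where "G y = (1 - y / R) * sin (y * t) / t - cos (y * t) / (R * t\<^sup>2)" for y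
  have "((\<lambda>y. (1 - y / R) * cos (y * t)) has_integral (G R - G 0)) {0..R}"
    using assms False unfolding G_def
    by (intro fundamental_theorem_of_calculus)
      (auto intro!: derivative_eq_intros simp: has_real_derivative_iff_has_vector_derivative[symmetric]
         field_simps power2_eq_square)
  moreover have "G R - G 0 = fejer R t"
    using False assms by (simp add: G_def fejer_def diff_divide_distrib)
  ultimately show ?thesis by simp
qed

lemma fejer_nonneg: "R > 0 \<Longrightarrow> 0 \<le> fejer R t"
  by (auto simp: fejer_def)

lemma fejer_le_half:
  assumes "R > 0"
  shows "fejer R t \<le> R / 2"
proof (cases "t = 0")
  case False
  have "1 - cos (R * t) \<le> R / 2 * (R * t\<^sup>2)"
    using one_minus_cos_le[of "R * t"] by (simp add: power2_eq_square mult_ac)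
  then show ?thesis using False assms by (simp add: fejer_def pos_divide_le_eq)
qed (simp add: fejer_def)

lemma fejer_le_inverse_square: "R > 0 \<Longrightarrow> t \<noteq> 0 \<Longrightarrow> fejer R t \<le> 2 / (R * t\<^sup>2)"
  using cos_ge_minus_one[of "R * t"] by (simp add: fejer_def divide_right_mono)

lemma cmod_sum_cis_squared:
  fixes x :: "'a \<Rightarrow> real"
  shows "(cmod (\<Sum>a\<in>A. cis (y * x a)))\<^sup>2 = (\<Sum>a\<in>A. \<Sum>b\<in>A. cos (y * (x a - x b)))"
proof -
  have "complex_of_real ((cmod (\<Sum>a\<in>A. cis (y * x a)))\<^sup>2) = (\<Sum>a\<in>A. cis (y * x a)) * cnj (\<Sum>a\<in>A. cis (y * x a))"
    by (metis complex_norm_square)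
  also have "\<dots> = (\<Sum>a\<in>A. \<Sum>b\<in>A. cis (y * (x a - x b)))"
    by (simp add: sum_product cis_cnj cis_mult right_diff_distrib)
  finally have "Re (complex_of_real ((cmod (\<Sum>a\<in>A. cis (y * x a)))\<^sup>2)) = Re (\<Sum>a\<in>A. \<Sum>b\<in>A. cis (y * (x a - x b)))"
    by simp
  then show ?thesis by simp
qed

text \<open>Links the mean square of an exponential sum to its frequencies. As the kernel is
  nonnegative, the double sum can be bounded above by counting close pairs and below by its
  diagonal.\<close>

lemma has_integral_fejer_sum:
  fixes x :: "'a \<Rightarrow> real"
  assumes "finite A" "R > 0"
  shows "((\<lambda>y. (1 - y / R) * (cmod (\<Sum>a\<in>A. cis (y * x a)))\<^sup>2) has_integral
           (\<Sum>a\<in>A. \<Sum>b\<in>A. fejer R (x a - x b))) {0..R}"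
  unfolding cmod_sum_cis_squared sum_distrib_left
  by (intro has_integral_sum has_integral_fejer assms)

lemma sum_inverse_squares_le: "(\<Sum>j\<in>{2..M}. 1 / (real j - 1)\<^sup>2) \<le> 2"
proof -
  have "(\<Sum>j\<in>{2..M}. 1 / (real j - 1)\<^sup>2) \<le> 2 - 1 / (real M - 1)" if "M \<ge> 2"
    using that
  proof (induction M rule: dec_induct)
    case (step n)
    have "1 / (real n)\<^sup>2 \<le> 1 / (real n - 1) - 1 / real n"
      using step by (simp add: field_simps power2_eq_square)
    then show ?case using step by simp
  qed simp
  moreover have "2 - 1 / (real M - 1) \<le> 2" if "M \<ge> 2" using that by simp
  ultimately have "(\<Sum>j\<in>{2..M}. 1 / (real j - 1)\<^sup>2) \<le> 2" if "M \<ge> 2"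
    using that by (meson order_trans)
  then show ?thesis by (cases "M \<ge> 2") auto
qed

lemma sum_int_symmetric:
  fixes g :: "nat \<Rightarrow> real"
  shows "(\<Sum>k\<in>{- int M..int M}. g (nat \<bar>k\<bar>)) = g 0 + 2 * (\<Sum>j\<in>{1..M}. g j)"
proof -
  have "{- int M..int M} = insert 0 (int ` {1..M} \<union> (\<lambda>j. - int j) ` {1..M})"
  proof (intro equalityI subsetI)
    fix k assume k: "k \<in> {- int M..int M}"
    consider "k = 0" | "k > 0" | "k < 0" by linarith
    then show "k \<in> insert 0 (int ` {1..M} \<union> (\<lambda>j. - int j) ` {1..M})"
    proof cases
      case 2 then show ?thesis using k by (intro insertI2 UnI1 image_eqI[of _ _ "nat k"]) auto
    next
      case 3 then show ?thesis using k by (intro insertI2 UnI2 image_eqI[of _ _ "nat (-k)"]) auto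
    qed simp
  qed auto
  moreover have "int ` {1..M} \<inter> (\<lambda>j. - int j) ` {1..M} = {}" by auto
  ultimately have "(\<Sum>k\<in>{- int M..int M}. g (nat \<bar>k\<bar>)) =
      g 0 + ((\<Sum>k\<in>int ` {1..M}. g (nat \<bar>k\<bar>)) + (\<Sum>k\<in>(\<lambda>j. - int j) ` {1..M}. g (nat \<bar>k\<bar>)))"
    by (simp, subst sum.insert) (auto intro!: sum.union_disjoint)
  then show ?thesis by (simp add: sum.reindex inj_on_def)
qed

text \<open>Group the pairs by difference of bin indices at width 4/R. The groups are no larger than
  the one of difference 0, and the kernel decays quadratically in the difference, so the series over
  all groups sums to at most 2 R.\<close>

lemma fejer_sum_le:
  fixes x :: "'a \<Rightarrow> real"
  assumes fin: "finite A" and R: "R > 0"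
  shows "(\<Sum>a\<in>A. \<Sum>b\<in>A. fejer R (x a - x b)) \<le> 2 * R * card {(a, b) \<in> A \<times> A. \<bar>x a - x b\<bar> \<le> 4 / R}"
proof -
  define h where "h = 4 / R"
  have h: "h > 0" using R by (simp add: h_def)
  define \<kappa> where "\<kappa> p = \<lfloor>x (snd p) / h\<rfloor> - \<lfloor>x (fst p) / h\<rfloor>" for p :: "'a \<times> 'a"
  define F where "F p = fejer R (x (fst p) - x (snd p))" for p :: "'a \<times> 'a"
  define M where "M = Max (insert 0 ((\<lambda>p. nat \<bar>\<kappa> p\<bar>) ` (A \<times> A)))"
  \<comment> \<open>If the bin indices differ by j >= 2, the points are at least (j - 1) h apart,
    and 2 / (R t^2) becomes R / (8 (j - 1)^2) because h = 4/R.\<close>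
  define g where "g j = (if j \<le> 1 then R / 2 else R / (8 * (real j - 1)\<^sup>2))" for j :: nat
  define c where "c = real (card (bin_pairs h x A 0))"
  have T: "{p \<in> A \<times> A. \<kappa> p = k} = bin_pairs h x A k" for k
    by (auto simp: bin_pairs_def \<kappa>_def)
  have sub: "\<kappa> ` (A \<times> A) \<subseteq> {- int M..int M}"
  proof
    fix k assume "k \<in> \<kappa> ` (A \<times> A)"
    then have "nat \<bar>k\<bar> \<le> M" unfolding M_def using fin by (intro Max_ge) auto
    then show "k \<in> {- int M..int M}" by auto
  qed
  have Fg: "F p \<le> g (nat \<bar>\<kappa> p\<bar>)" for p
  proof (cases "nat \<bar>\<kappa> p\<bar> \<le> 1")
    case True then show ?thesis using fejer_le_half[OF R] by (simp add: g_def F_def)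
  next
    case False
    define u where "u = x (fst p) - x (snd p)"
    define j where "j = real_of_int \<bar>\<kappa> p\<bar> - 1"
    have j: "j \<ge> 1" using False by (simp add: j_def)
    have "x (fst p) / h - x (snd p) / h = u / h" by (simp add: u_def diff_divide_distrib)
    then have "j \<le> \<bar>u / h\<bar>"
      unfolding j_def \<kappa>_def by linarith
    then have ju: "j * h \<le> \<bar>u\<bar>" using h by (simp add: abs_divide pos_le_divide_eq)
    then have u0: "u \<noteq> 0" using j h by (auto simp: mult_le_0_iff)
    have "(j * h)\<^sup>2 \<le> \<bar>u\<bar>\<^sup>2" using ju j h by (intro power_mono) auto
    then have "2 / (R * u\<^sup>2) \<le> 2 / (R * (j * h)\<^sup>2)"
      using R j h u0 by (intro divide_left_mono mult_left_mono) auto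
    also have "\<dots> = R / (8 * j\<^sup>2)" using R j by (simp add: h_def power2_eq_square field_simps)
    finally have "fejer R u \<le> R / (8 * j\<^sup>2)" using fejer_le_inverse_square[OF R u0] by linarith
    then show ?thesis using False by (simp add: g_def F_def u_def j_def)
  qed
  have g0: "g j \<ge> 0" for j using R by (simp add: g_def)
  have "(\<Sum>a\<in>A. \<Sum>b\<in>A. fejer R (x a - x b)) = (\<Sum>p\<in>A \<times> A. F p)"
    by (simp add: sum.cartesian_product F_def split_def)
  also have "\<dots> = (\<Sum>k\<in>\<kappa> ` (A \<times> A). \<Sum>p\<in>bin_pairs h x A k. F p)"
    using fin by (subst sum.image_gen[of _ _ \<kappa>]) (auto simp: T)
  also have "\<dots> \<le> (\<Sum>k\<in>\<kappa> ` (A \<times> A). c * g (nat \<bar>k\<bar>))"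
  proof (rule sum_mono)
    fix k
    have "(\<Sum>p\<in>bin_pairs h x A k. F p) \<le> (\<Sum>p\<in>bin_pairs h x A k. g (nat \<bar>k\<bar>))"
    proof (rule sum_mono)
      fix p assume "p \<in> bin_pairs h x A k"
      then have "\<kappa> p = k" using T by blast
      then show "F p \<le> g (nat \<bar>k\<bar>)" using Fg[of p] by simp
    qed
    also have "\<dots> = real (card (bin_pairs h x A k)) * g (nat \<bar>k\<bar>)" by simp
    also have "\<dots> \<le> c * g (nat \<bar>k\<bar>)"
      unfolding c_def using card_bin_pairs_le[OF fin] g0 by (intro mult_right_mono) auto
    finally show "(\<Sum>p\<in>bin_pairs h x A k. F p) \<le> c * g (nat \<bar>k\<bar>)" .
  qed
  also have "\<dots> \<le> (\<Sum>k\<in>{- int M..int M}. c * g (nat \<bar>k\<bar>))"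
    using sub g0 by (intro sum_mono2) (auto simp: c_def)
  also have "\<dots> = c * (g 0 + 2 * (\<Sum>j\<in>{1..M}. g j))"
    by (simp add: sum_distrib_left[symmetric] sum_int_symmetric)
  also have "\<dots> \<le> c * (2 * R)"
  proof (intro mult_left_mono)
    have "(\<Sum>j\<in>{1..M}. g j) \<le> (\<Sum>j\<in>insert 1 {2..M}. g j)"
      using g0 by (intro sum_mono2) auto
    also have "\<dots> = R / 2 + R / 8 * (\<Sum>j\<in>{2..M}. 1 / (real j - 1)\<^sup>2)"
      by (simp add: g_def sum_distrib_left)
    also have "\<dots> \<le> R / 2 + R / 8 * 2"
      using R sum_inverse_squares_le[of M] by (intro add_left_mono mult_left_mono) auto
    finally show "g 0 + 2 * (\<Sum>j\<in>{1..M}. g j) \<le> 2 * R" by (simp add: g_def)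
  qed (simp add: c_def)
  also have "\<dots> \<le> 2 * R * card {(a, b) \<in> A \<times> A. \<bar>x a - x b\<bar> \<le> h}"
  proof -
    have "bin_pairs h x A 0 \<subseteq> {(a, b) \<in> A \<times> A. \<bar>x a - x b\<bar> \<le> h}"
      using h by (rule bin_pairs_0_subset)
    then have "card (bin_pairs h x A 0) \<le> card {(a, b) \<in> A \<times> A. \<bar>x a - x b\<bar> \<le> h}"
      using fin by (intro card_mono[OF finite_subset[of _ "A \<times> A"]]) auto
    then show ?thesis using R by (simp add: c_def)
  qed
  finally show ?thesis by (simp add: h_def)
qed

section \<open>Digit systems and their shadows\<close>

definition digits :: "int set" where "digits = {-1, 0, 1}"

definition words :: "nat \<Rightarrow> int list set" where
  "words n = {w. set w \<subseteq> digits \<and> length w = n}"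

lemma finite_digits [simp]: "finite digits" and card_digits [simp]: "card digits = 3"
  by (simp_all add: digits_def)

lemma finite_words [simp]: "finite (words n)"
  unfolding words_def by (rule finite_lists_length_eq) simp

lemma card_words [simp]: "card (words n) = 3 ^ n"
  unfolding words_def by (simp add: card_lists_length_eq)

lemma length_words: "w \<in> words n \<Longrightarrow> length w = n"
  by (simp add: words_def)

lemma words_0 [simp]: "words 0 = {[]}"
  by (auto simp: words_def)

lemma take_words: "w \<in> words n \<Longrightarrow> j \<le> n \<Longrightarrow> take j w \<in> words j"
  by (auto simp: words_def dest: in_set_takeD)

lemma drop_words: "w \<in> words n \<Longrightarrow> drop j w \<in> words (n - j)"
  by (auto simp: words_def dest: in_set_dropD)

lemma append_words: "u \<in> words i \<Longrightarrow> v \<in> words j \<Longrightarrow> u @ v \<in> words (i + j)"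
  by (auto simp: words_def)

lemma inj_on_append_words: "inj_on (\<lambda>(u, v). u @ v) (words i \<times> words j)"
  by (auto simp: inj_on_def words_def)

lemma words_add: "words (i + j) = (\<lambda>(u, v). u @ v) ` (words i \<times> words j)"
proof (intro equalityI subsetI)
  fix w assume "w \<in> words (i + j)"
  then show "w \<in> (\<lambda>(u, v). u @ v) ` (words i \<times> words j)"
    using take_words[of w "i + j" i] drop_words[of w "i + j" i]
    by (intro image_eqI[of _ _ "(take i w, drop i w)"]) auto
qed (auto simp: append_words)

lemma card_words_prefix:
  assumes "S \<subseteq> words j" "j \<le> n"
  shows "card {w \<in> words n. take j w \<in> S} = card S * 3 ^ (n - j)"
proof -
  have "{w \<in> words n. take j w \<in> S} = (\<lambda>(u, v). u @ v) ` (S \<times> words (n - j))"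
  proof (intro equalityI subsetI)
    fix w assume "w \<in> {w \<in> words n. take j w \<in> S}"
    then show "w \<in> (\<lambda>(u, v). u @ v) ` (S \<times> words (n - j))"
      using drop_words[of w n j] by (intro image_eqI[of _ _ "(take j w, drop j w)"]) auto
  next
    fix w assume "w \<in> (\<lambda>(u, v). u @ v) ` (S \<times> words (n - j))"
    then obtain u v where "w = u @ v" "u \<in> S" "v \<in> words (n - j)" by auto
    then show "w \<in> {w \<in> words n. take j w \<in> S}"
      using assms append_words[of u j v "n - j"] by (auto simp: length_words subset_iff)
  qed
  moreover have "inj_on (\<lambda>(u, v). u @ v) (S \<times> words (n - j))"
    using inj_on_append_words by (rule inj_on_subset) (use assms in auto)
  ultimately show ?thesis by (simp add: card_image card_cartesian_product)
qed

text \<open>The digits only label the three unit vectors; \<open>d\<close> gives their projections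
  for one fixed direction. That these sum to 0 is assumed later, where the Fourier argument needs
  it.\<close>

locale digit_system =
  fixes d :: "int \<Rightarrow> real"
  assumes abs_d_le: "a \<in> digits \<Longrightarrow> \<bar>d a\<bar> \<le> 1"
begin

primrec val :: "int list \<Rightarrow> real" where
  "val [] = 0"
| "val (a # w) = (d a + val w) / 3"

lemma val_append: "val (u @ v) = val u + (1 / 3) ^ length u * val v"
  by (induction u) (simp_all add: field_simps)

lemma abs_val_le: "w \<in> words n \<Longrightarrow> \<bar>val w\<bar> \<le> (1 - (1 / 3) ^ n) / 2"
proof (induction n arbitrary: w)
  case (Suc n)
  then obtain a v where w: "w = a # v" "a \<in> digits" "v \<in> words n"
    by (cases w) (auto simp: words_def)
  then have "\<bar>d a + val v\<bar> \<le> 1 + (1 - (1 / 3) ^ n) / 2"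
    using Suc.IH[of v] abs_d_le[of a] by linarith
  then show ?case by (simp add: w abs_divide field_simps)
qed simp

lemma abs_val_diff_take_le:
  assumes "w \<in> words n" "j \<le> n"
  shows "\<bar>val w - val (take j w)\<bar> \<le> ((1 / 3) ^ j - (1 / 3) ^ n) / 2"
proof -
  have "val w = val (take j w) + (1 / 3) ^ j * val (drop j w)"
    using val_append[of "take j w" "drop j w"] assms by (simp add: length_words)
  moreover have "(1 / 3) ^ j * \<bar>val (drop j w)\<bar> \<le> (1 / 3) ^ j * ((1 - (1 / 3) ^ (n - j)) / 2)"
    using abs_val_le[OF drop_words[OF assms(1)], of j] by (intro mult_left_mono) auto
  moreover have "(1 / 3 :: real) ^ j * (1 / 3) ^ (n - j) = (1 / 3) ^ n"
    using assms by (simp flip: power_add)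
  ultimately show ?thesis by (simp add: abs_mult right_diff_distrib)
qed

text \<open>The bound 2 * 3^(-n) says that the closed intervals of radius 3^(-n) meet.\<close>

definition nbrs :: "int list \<Rightarrow> int list set" where
  "nbrs w = {v \<in> words (length w). \<bar>val v - val w\<bar> \<le> 2 * (1 / 3) ^ length w}"

lemma nbrs_subset: "w \<in> words n \<Longrightarrow> nbrs w \<subseteq> words n"
  by (auto simp: nbrs_def length_words)

lemma finite_nbrs [simp]: "finite (nbrs w)"
  by (auto simp: nbrs_def)

lemma self_nbrs: "w \<in> words n \<Longrightarrow> w \<in> nbrs w"
  by (simp add: nbrs_def length_words)

lemma nbrs_Nil: "nbrs [] = {[]}"
  by (auto simp: nbrs_def)

text \<open>Cutting at \<open>j\<close> moves each value by at most (3^(-j) - 3^(-n)) / 2, so the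
  prefixes of two neighbours are at most 3^(-j) + 3^(-n) apart.\<close>

lemma nbrs_take:
  assumes "v \<in> nbrs w" "w \<in> words n" "j \<le> n"
  shows "take j v \<in> nbrs (take j w)"
proof (cases "j = n")
  case True
  then show ?thesis using assms nbrs_subset[of w n] by (auto simp: length_words)
next
  case False
  have v: "v \<in> words n" using assms nbrs_subset by auto
  have "(1 / 3 :: real) ^ n \<le> (1 / 3) ^ Suc j"
    using False assms by (intro power_decreasing) auto
  then have "(1 / 3 :: real) ^ n \<le> (1 / 3) ^ j / 3" by simp
  moreover have "\<bar>val v - val w\<bar> \<le> 2 * (1 / 3) ^ n" using assms by (simp add: nbrs_def length_words)
  moreover note abs_val_diff_take_le[OF v assms(3)] abs_val_diff_take_le[OF assms(2,3)]
  ultimately have "\<bar>val (take j v) - val (take j w)\<bar> \<le> 2 * (1 / 3) ^ j" by argo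
  then show ?thesis using v assms by (simp add: nbrs_def take_words length_words)
qed

text \<open>Each neighbour extends a neighbour of the prefix by one of three digits. This caps the
  neighbours of a word that has just become heavy.\<close>

lemma card_nbrs_Suc_le:
  assumes "w \<in> words (Suc n)"
  shows "card (nbrs w) \<le> 3 * card (nbrs (take n w))"
proof -
  have "nbrs w \<subseteq> {v \<in> words (Suc n). take n v \<in> nbrs (take n w)}"
    using nbrs_take[OF _ assms, of _ n] nbrs_subset[OF assms] by auto
  then have "card (nbrs w) \<le> card {v \<in> words (Suc n). take n v \<in> nbrs (take n w)}"
    by (intro card_mono) auto
  also have "\<dots> = card (nbrs (take n w)) * 3"
    using nbrs_subset[OF take_words[OF assms, of n]] by (subst card_words_prefix) auto
  finally show ?thesis by simp
qed

section \<open>Shadows, their self-similarity and the covering argument\<close>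

definition shadow :: "nat \<Rightarrow> real set" where
  "shadow n = (\<Union>w\<in>words n. ball (val w) ((1 / 3) ^ n))"

lemma shadow_lmeasurable: "shadow n \<in> lmeasurable"
  unfolding shadow_def by (intro fmeasurable.finite_UN) auto

lemma shadow_subset_ball: "shadow n \<subseteq> ball 0 1"
proof
  fix x assume "x \<in> shadow n"
  then obtain w where w: "w \<in> words n" "\<bar>x - val w\<bar> < (1 / 3) ^ n"
    by (auto simp: shadow_def dist_real_def)
  have "(1 / 3 :: real) ^ n \<le> 1" by (simp add: power_le_one)
  then show "x \<in> ball 0 1" using abs_val_le[OF w(1)] w(2) by (simp add: dist_real_def)
qed

lemma shadow_add:
  "shadow (i + j) = (\<Union>u\<in>words i. (\<lambda>x. (1 / 3) ^ i *\<^sub>R x + val u) ` shadow j)"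
proof -
  have "(\<lambda>x. (1 / 3) ^ i *\<^sub>R x + val u) ` ball (val v) ((1 / 3) ^ j) = ball (val (u @ v)) ((1 / 3) ^ (i + j))"
    if "u \<in> words i" for u v
  proof -
    have "(\<lambda>x. (1 / 3) ^ i *\<^sub>R x + val u) ` ball (val v) ((1 / 3) ^ j) =
       (\<lambda>x. x + val u) ` (\<lambda>x. (1 / 3) ^ i *\<^sub>R x) ` ball (val v) ((1 / 3) ^ j)"
      by (simp add: image_image)
    also have "\<dots> = (+) (val u) ` ball ((1 / 3) ^ i *\<^sub>R val v) ((1 / 3) ^ i * (1 / 3) ^ j)"
      by (subst ball_scale) (simp_all add: add.commute)
    also have "\<dots> = ball (val u + (1 / 3) ^ i *\<^sub>R val v) ((1 / 3) ^ i * (1 / 3) ^ j)"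
      by (subst add.commute) (rule image_add_ball)
    finally have "(\<lambda>x. (1 / 3) ^ i *\<^sub>R x + val u) ` ball (val v) ((1 / 3) ^ j) =
        ball (val u + (1 / 3) ^ i *\<^sub>R val v) ((1 / 3) ^ i * (1 / 3) ^ j)" .
    then show ?thesis using that by (simp add: val_append length_words power_add)
  qed
  then show ?thesis
    by (auto simp: shadow_def words_add image_UN)
qed

lemma shadow_antimono: "m \<le> n \<Longrightarrow> shadow n \<subseteq> shadow m"
proof -
  assume "m \<le> n"
  then have "shadow n = shadow (m + (n - m))" by simp
  also have "\<dots> \<subseteq> shadow m"
  proof -
    have "(\<lambda>x. (1 / 3) ^ m *\<^sub>R x + val u) ` shadow (n - m) \<subseteq> ball (val u) ((1 / 3) ^ m)" for u
      using shadow_subset_ball[of "n - m"] by (auto simp: dist_real_def abs_mult subset_iff)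
    then show ?thesis unfolding shadow_add by (subst (2) shadow_def) blast
  qed
  finally show ?thesis .
qed

text \<open>Words with a prefix next to a heavy word, not only with a heavy prefix: thus a single
  heavy word of length j accounts for at least K 3^(N - j) good words.\<close>

definition good_words :: "real \<Rightarrow> nat \<Rightarrow> int list set" where
  "good_words K N = {\<alpha> \<in> words N. \<exists>j\<le>N. \<exists>w\<in>words j. K \<le> card (nbrs w) \<and> take j \<alpha> \<in> nbrs w}"

lemma good_words_subset: "good_words K N \<subseteq> words N"
  by (auto simp: good_words_def)

lemma finite_good_words [simp]: "finite (good_words K N)"
  using good_words_subset by (rule finite_subset) simp

text \<open>Cover by balls around heavy words and select a disjoint subfamily \<open>C\<close> by
  Vitali. The good words accounted for by different members of \<open>C\<close> are disjoint, so the
  sum of 3^(-|w|) over \<open>C\<close> is at most the proportion of good words divided by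
  \<open>K\<close>. The factor 40 is 2 * 5 * 4: diameter, Vitali enlargement, radius.\<close>

lemma measure_good_balls_le:
  assumes K: "K > 0"
  shows "measure lebesgue (\<Union>\<alpha>\<in>good_words K N. ball (val \<alpha>) ((1 / 3) ^ N)) \<le> 40 * (card (good_words K N) / 3 ^ N) / K"
proof -
  define H where "H = {w. set w \<subseteq> digits \<and> length w \<le> N \<and> K \<le> card (nbrs w)}"
  define S where "S = (\<Union>\<alpha>\<in>good_words K N. ball (val \<alpha>) ((1 / 3) ^ N))"
  \<comment> \<open>A word extending a neighbour of \<open>w\<close> is within 2 + 1/2 units of
    3^(-|w|) of \<open>w\<close>, and its own ball adds at most 1; hence 4 is enough.\<close>
  define r where "r w = 4 * (1 / 3 :: real) ^ length w" for w :: "int list"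
  define G where "G w = {\<alpha> \<in> words N. take (length w) \<alpha> \<in> nbrs w}" for w
  have finH: "finite H"
    by (rule finite_subset[OF _ finite_lists_length_le[of digits N]]) (auto simp: H_def)
  have HW: "w \<in> words (length w)" "length w \<le> N" "K \<le> card (nbrs w)" if "w \<in> H" for w
    using that by (auto simp: H_def words_def)
  have near: "\<bar>val \<alpha> - val w\<bar> \<le> 5 / 2 * (1 / 3) ^ length w" if "w \<in> H" "\<alpha> \<in> G w" for w \<alpha>
  proof -
    have "\<bar>val (take (length w) \<alpha>) - val w\<bar> \<le> 2 * (1 / 3) ^ length w"
      using that by (simp add: G_def nbrs_def)
    moreover have "\<bar>val \<alpha> - val (take (length w) \<alpha>)\<bar> \<le> ((1 / 3) ^ length w - (1 / 3) ^ N) / 2"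
      using that HW by (intro abs_val_diff_take_le) (auto simp: G_def)
    moreover have "(1 / 3 :: real) ^ N \<ge> 0" by simp
    ultimately show ?thesis by argo
  qed
  have "S \<subseteq> (\<Union>w\<in>H. ball (val w) (r w))"
  proof
    fix x assume "x \<in> S"
    then obtain \<alpha> where \<alpha>: "\<alpha> \<in> good_words K N" and x: "\<bar>x - val \<alpha>\<bar> < (1 / 3) ^ N"
      by (auto simp: S_def dist_real_def)
    then obtain j w where j: "j \<le> N" "w \<in> words j" "K \<le> card (nbrs w)" "take j \<alpha> \<in> nbrs w" "\<alpha> \<in> words N"
      by (auto simp: good_words_def)
    then have w: "w \<in> H" "\<alpha> \<in> G w" by (auto simp: H_def words_def G_def)
    have "(1 / 3 :: real) ^ N \<le> (1 / 3) ^ length w"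
      using HW[OF w(1)] by (intro power_decreasing) auto
    moreover have "(1 / 3 :: real) ^ length w > 0" by simp
    ultimately have "\<bar>x - val w\<bar> < r w" using near[OF w] x unfolding r_def by linarith
    then show "x \<in> (\<Union>w\<in>H. ball (val w) (r w))" using w(1) by (auto simp: dist_real_def abs_minus_commute)
  qed
  moreover have "0 < r w \<and> r w \<le> 4" for w
    by (simp add: r_def power_le_one)
  ultimately obtain C where C: "C \<subseteq> H"
     "pairwise (\<lambda>i j. disjnt (ball (val i) (r i)) (ball (val j) (r j))) C"
     "S \<subseteq> (\<Union>w\<in>C. ball (val w) (5 * r w))"
    by (rule Vitali_covering_lemma_balls) blast
  have finC: "finite C" using C(1) finH by (rule finite_subset)
  have "K * (\<Sum>w\<in>C. 3 ^ (N - length w)) \<le> (\<Sum>w\<in>C. real (card (G w)))"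
    unfolding sum_distrib_left
  proof (rule sum_mono)
    fix w assume "w \<in> C"
    then have w: "w \<in> H" using C by auto
    then have "card (G w) = card (nbrs w) * 3 ^ (N - length w)"
      unfolding G_def using HW nbrs_subset by (intro card_words_prefix) auto
    then show "K * 3 ^ (N - length w) \<le> real (card (G w))"
      using HW[OF w] by (simp add: mult_right_mono)
  qed
  also have "\<dots> = real (card (\<Union>w\<in>C. G w))"
  proof -
    have "G v \<inter> G w = {}" if vw: "v \<in> C" "w \<in> C" "v \<noteq> w" for v w
    proof -
      have "G u \<subseteq> {\<alpha>. val \<alpha> \<in> ball (val u) (r u)}" if "u \<in> C" for u
      proof clarify
        fix \<alpha> assume \<alpha>: "\<alpha> \<in> G u"
        have "u \<in> H" using that C by auto
        note near[OF this \<alpha>]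
        moreover have "(1 / 3 :: real) ^ length u > 0" by simp
        ultimately have "\<bar>val \<alpha> - val u\<bar> < r u" unfolding r_def by linarith
        then show "val \<alpha> \<in> ball (val u) (r u)" by (simp add: dist_real_def abs_minus_commute)
      qed
      moreover have "disjnt (ball (val v) (r v)) (ball (val w) (r w))"
        using C(2) vw by (auto simp: pairwise_def)
      ultimately show ?thesis using vw unfolding disjnt_def by blast
    qed
    then have "card (\<Union>w\<in>C. G w) = (\<Sum>w\<in>C. card (G w))"
      using finC by (intro card_UN_disjoint) (auto simp: G_def)
    then show ?thesis by simp
  qed
  also have "\<dots> \<le> real (card (good_words K N))"
  proof (intro of_nat_mono card_mono UN_least)
    fix w assume "w \<in> C"
    then have "w \<in> H" using C(1) by auto
    then show "G w \<subseteq> good_words K N" using HW[of w] unfolding G_def good_words_def by blast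
  qed simp
  finally have count: "K * (\<Sum>w\<in>C. 3 ^ (N - length w)) \<le> card (good_words K N)" .
  have "measure lebesgue S \<le> measure lebesgue (\<Union>w\<in>C. ball (val w) (5 * r w))"
    using C(3) finC by (intro measure_mono_fmeasurable fmeasurable.finite_UN) (auto simp: S_def)
  also have "\<dots> \<le> (\<Sum>w\<in>C. measure lebesgue (ball (val w) (5 * r w)))"
    using finC by (intro measure_UNION_le) auto
  also have "\<dots> = (\<Sum>w\<in>C. 40 / 3 ^ N * 3 ^ (N - length w))"
  proof (rule sum.cong[OF refl])
    fix w assume "w \<in> C"
    then have "length w \<le> N" using C HW by auto
    then have "(1 / 3 :: real) ^ length w = 3 ^ (N - length w) / 3 ^ N"
      by (simp add: power_diff power_one_over)
    then show "measure lebesgue (ball (val w) (5 * r w)) = 40 / 3 ^ N * 3 ^ (N - length w)"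
      using measure_ball_real[of "5 * r w" "val w"] by (simp add: r_def)
  qed
  also have "\<dots> = 40 / 3 ^ N * (\<Sum>w\<in>C. 3 ^ (N - length w))" by (simp add: sum_distrib_left)
  also have "\<dots> \<le> 40 / 3 ^ N * (card (good_words K N) / K)"
    using count K by (intro mult_left_mono) (simp_all add: pos_le_divide_eq mult.commute)
  finally show ?thesis by (simp add: S_def)
qed

text \<open>Good words of length \<open>N\<close> are covered as above; each other word carries a
  copy of \<open>shadow n\<close> scaled by 3^(-N), and these are simply added up.\<close>

lemma measure_shadow_add_le:
  fixes N :: nat
  assumes K: "K > 0"
  defines "q \<equiv> card (good_words K N) / 3 ^ N"
  shows "measure lebesgue (shadow (N + n)) \<le> 40 * q / K + (1 - q) * measure lebesgue (shadow n)"
proof -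
  define T where "T u = (\<lambda>x. (1 / 3) ^ N *\<^sub>R x + val u) ` shadow n" for u
  have T: "measure lebesgue (T u) = (1 / 3) ^ N * measure lebesgue (shadow n)" for u
    using measure_lebesgue_affine[of "(1 / 3) ^ N" "val u" "shadow n"] by (simp add: T_def)
  have Tm: "T u \<in> lmeasurable" for u
  proof -
    have "open (T u)" unfolding T_def shadow_def image_UN
      using open_affinity[of "ball (val _) _" "(1 / 3 :: real) ^ N" "val u"]
      by (intro open_UN) (auto simp: add.commute)
    moreover have "bounded (T u)" unfolding T_def
      by (rule bounded_subset[OF bounded_ball, of _ "val u" "(1 / 3) ^ N"])
        (use shadow_subset_ball[of n] in \<open>auto simp: dist_real_def abs_mult subset_iff\<close>)
    ultimately show ?thesis by (rule lmeasurable_open[rotated])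
  qed
  have "shadow (N + n) \<subseteq> (\<Union>\<alpha>\<in>good_words K N. ball (val \<alpha>) ((1 / 3) ^ N)) \<union> (\<Union>u\<in>words N - good_words K N. T u)"
  proof -
    have "T u \<subseteq> ball (val u) ((1 / 3) ^ N)" for u
      using shadow_subset_ball[of n] by (auto simp: T_def dist_real_def abs_mult subset_iff)
    then show ?thesis unfolding shadow_add T_def[symmetric] by blast
  qed
  then have "measure lebesgue (shadow (N + n)) \<le>
     measure lebesgue ((\<Union>\<alpha>\<in>good_words K N. ball (val \<alpha>) ((1 / 3) ^ N)) \<union> (\<Union>u\<in>words N - good_words K N. T u))"
    using shadow_lmeasurable Tm
    by (intro measure_mono_fmeasurable fmeasurable.Un fmeasurable.finite_UN) (auto simp: fmeasurableD)
  also have "\<dots> \<le> measure lebesgue (\<Union>\<alpha>\<in>good_words K N. ball (val \<alpha>) ((1 / 3) ^ N)) +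
      measure lebesgue (\<Union>u\<in>words N - good_words K N. T u)"
    using Tm by (intro measure_Un_le fmeasurableD fmeasurable.finite_UN) auto
  also have "\<dots> \<le> 40 * q / K + (1 - q) * measure lebesgue (shadow n)"
  proof (rule add_mono)
    have "measure lebesgue (\<Union>u\<in>words N - good_words K N. T u) \<le> (\<Sum>u\<in>words N - good_words K N. measure lebesgue (T u))"
      using Tm by (intro measure_UNION_le) (auto simp: fmeasurableD)
    also have "\<dots> = (3 ^ N - real (card (good_words K N))) * ((1 / 3) ^ N * measure lebesgue (shadow n))"
    proof -
      have "card (words N - good_words K N) + card (good_words K N) = 3 ^ N"
        using card_mono[OF finite_words good_words_subset, of K N]
        by (simp add: card_Diff_subset good_words_subset)
      then have "real (card (words N - good_words K N) + card (good_words K N)) = real (3 ^ N)"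
        by (simp only:)
      then have "real (card (words N - good_words K N)) = 3 ^ N - real (card (good_words K N))"
        by simp
      then show ?thesis by (simp add: T)
    qed
    also have "\<dots> = (1 - q) * measure lebesgue (shadow n)"
      by (simp add: q_def field_simps power_one_over)
    finally show "measure lebesgue (\<Union>u\<in>words N - good_words K N. T u) \<le> (1 - q) * measure lebesgue (shadow n)" .
  qed (use measure_good_balls_le[OF K] in \<open>simp add: q_def\<close>)
  finally show ?thesis .
qed

text \<open>The recursion t -> 40 q / K + (1 - q) t fixes 40 / K, and the excess over it shrinks by
  the factor 1 - q at each step, starting from at most 2.\<close>

lemma measure_shadow_mult_le:
  fixes N :: nat
  assumes K: "K > 0"
  defines "q \<equiv> card (good_words K N) / 3 ^ N"
  shows "measure lebesgue (shadow (r * N)) \<le> 40 / K + 2 * (1 - q) ^ r"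
proof (induction r)
  case 0
  have "measure lebesgue (shadow 0) \<le> 2"
    using measure_ball_real[of 1 0] by (simp add: shadow_def)
  then show ?case using K by (simp add: add_increasing)
next
  case (Suc r)
  have "card (good_words K N) \<le> 3 ^ N"
    using card_mono[OF finite_words good_words_subset, of K N] by simp
  then have "real (card (good_words K N)) \<le> real (3 ^ N)" by (simp only: of_nat_le_iff)
  then have q: "q \<le> 1" by (simp add: q_def)
  have "measure lebesgue (shadow (N + r * N)) \<le> 40 * q / K + (1 - q) * measure lebesgue (shadow (r * N))"
    unfolding q_def by (rule measure_shadow_add_le[OF K])
  also have "\<dots> \<le> 40 * q / K + (1 - q) * (40 / K + 2 * (1 - q) ^ r)"
    using q Suc by (intro add_left_mono mult_left_mono) auto
  also have "\<dots> = 40 / K + 2 * (1 - q) ^ Suc r" using K by (simp add: field_simps)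
  finally show ?case by simp
qed

section \<open>Pair energy\<close>

text \<open>The mean number of neighbours of a word: a discrete L2 energy of the projected measure
  at scale 3^(-n).\<close>

definition energy :: "nat \<Rightarrow> real" where
  "energy n = (\<Sum>w\<in>words n. real (card (nbrs w))) / 3 ^ n"

lemma energy_eq_card_pairs:
  "3 ^ n * energy n = card {(u, w) \<in> words n \<times> words n. \<bar>val u - val w\<bar> \<le> 2 * (1 / 3) ^ n}"
proof -
  have "nbrs u = {w \<in> words n. \<bar>val u - val w\<bar> \<le> 2 * (1 / 3) ^ n}" if "u \<in> words n" for u
    using that by (auto simp: nbrs_def length_words abs_minus_commute)
  then show ?thesis
    by (subst card_pairs_eq) (simp_all add: energy_def cong: sum.cong)
qed

text \<open>A neighbour of w @ a has the form v @ b with \<open>v\<close> a neighbour of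
  \<open>w\<close>. For fixed \<open>v\<close> the condition on a and b is closeness at length n - j
  after a translation, and translations cost a factor 4.\<close>

lemma sum_card_nbrs_prefix_le:
  assumes w: "w \<in> words j" and "j \<le> n"
  shows "(\<Sum>\<alpha>\<in>{\<alpha> \<in> words n. take j \<alpha> = w}. real (card (nbrs \<alpha>))) \<le>
    4 * card (nbrs w) * (3 ^ (n - j) * energy (n - j))"
proof -
  define k where "k = n - j"
  have n: "n = j + k" using assms by (simp add: k_def)
  define E where "E t = {(a, b) \<in> words k \<times> words k. \<bar>val a - val b + t\<bar> \<le> 2 * (1 / 3) ^ k}" for t
  \<comment> \<open>The offset between the prefixes, magnified to the scale of the suffixes.\<close>
  define t where "t v = (val w - val v) * 3 ^ j" for v
  have eq: "{\<alpha> \<in> words n. take j \<alpha> = w} = (@) w ` words k"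
  proof (intro equalityI subsetI)
    fix \<alpha> assume "\<alpha> \<in> {\<alpha> \<in> words n. take j \<alpha> = w}"
    then show "\<alpha> \<in> (@) w ` words k"
      using drop_words[of \<alpha> n j] by (intro image_eqI[of _ _ "drop j \<alpha>"]) (auto simp: k_def)
  qed (use w in \<open>auto simp: n length_words append_words\<close>)
  have nb: "card (nbrs (w @ a)) \<le> (\<Sum>v\<in>nbrs w. card {b \<in> words k. \<bar>val a - val b + t v\<bar> \<le> 2 * (1 / 3) ^ k})"
    if a: "a \<in> words k" for a
  proof -
    have wa: "w @ a \<in> words n" using append_words[OF w a] n by simp
    have "nbrs (w @ a) \<subseteq> (\<Union>v\<in>nbrs w. (@) v ` {b \<in> words k. \<bar>val a - val b + t v\<bar> \<le> 2 * (1 / 3) ^ k})"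
    proof
      fix \<beta> assume \<beta>: "\<beta> \<in> nbrs (w @ a)"
      define v where "v = take j \<beta>"
      define b where "b = drop j \<beta>"
      have \<beta>w: "\<beta> \<in> words n" using \<beta> nbrs_subset[OF wa] by auto
      have v: "v \<in> nbrs w"
        using nbrs_take[OF \<beta> wa, of j] w n by (simp add: v_def length_words)
      have b: "b \<in> words k" using drop_words[OF \<beta>w, of j] by (simp add: b_def k_def)
      have lv: "length v = j" using v nbrs_subset[OF w] by (auto simp: length_words)
      have \<beta>_eq: "\<beta> = v @ b" by (simp add: v_def b_def)
      have "\<bar>val (v @ b) - val (w @ a)\<bar> \<le> 2 * (1 / 3) ^ n"
        using \<beta> length_words[OF wa] by (simp add: \<beta>_eq nbrs_def del: length_append)
      moreover have "val (v @ b) - val (w @ a) = - ((1 / 3) ^ j * (val a - val b + t v))"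
        using w lv by (simp add: val_append length_words t_def algebra_simps power_one_over)
      ultimately have "(1 / 3) ^ j * \<bar>val a - val b + t v\<bar> \<le> (1 / 3) ^ j * (2 * (1 / 3) ^ k)"
        by (simp add: abs_mult n power_add)
      then have "\<bar>val a - val b + t v\<bar> \<le> 2 * (1 / 3) ^ k"
        by (rule mult_left_le_imp_le) simp
      then show "\<beta> \<in> (\<Union>v\<in>nbrs w. (@) v ` {b \<in> words k. \<bar>val a - val b + t v\<bar> \<le> 2 * (1 / 3) ^ k})"
        using v b \<beta>_eq by blast
    qed
    then have "card (nbrs (w @ a)) \<le> card (\<Union>v\<in>nbrs w. (@) v ` {b \<in> words k. \<bar>val a - val b + t v\<bar> \<le> 2 * (1 / 3) ^ k})"
      by (intro card_mono) auto
    also have "\<dots> \<le> (\<Sum>v\<in>nbrs w. card ((@) v ` {b \<in> words k. \<bar>val a - val b + t v\<bar> \<le> 2 * (1 / 3) ^ k}))"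
      by (rule card_UN_le) simp
    also have "\<dots> \<le> (\<Sum>v\<in>nbrs w. card {b \<in> words k. \<bar>val a - val b + t v\<bar> \<le> 2 * (1 / 3) ^ k})"
      by (intro sum_mono card_image_le) simp
    finally show ?thesis .
  qed
  have "(\<Sum>\<alpha>\<in>{\<alpha> \<in> words n. take j \<alpha> = w}. card (nbrs \<alpha>)) = (\<Sum>a\<in>words k. card (nbrs (w @ a)))"
    unfolding eq by (subst sum.reindex) (auto simp: inj_on_def)
  also have "\<dots> \<le> (\<Sum>a\<in>words k. \<Sum>v\<in>nbrs w. card {b \<in> words k. \<bar>val a - val b + t v\<bar> \<le> 2 * (1 / 3) ^ k})"
    by (intro sum_mono nb)
  also have "\<dots> = (\<Sum>v\<in>nbrs w. card (E (t v)))"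
    unfolding E_def by (subst sum.swap, intro sum.cong refl, subst card_pairs_eq) simp_all
  also have "\<dots> \<le> (\<Sum>v\<in>nbrs w. 4 * card (E 0))"
    unfolding E_def using card_shifted_pairs_le[of "words k" "2 * (1 / 3) ^ k" val]
    by (intro sum_mono) simp
  also have "\<dots> = 4 * card (nbrs w) * card (E 0)" by simp
  finally have "real (\<Sum>\<alpha>\<in>{\<alpha> \<in> words n. take j \<alpha> = w}. card (nbrs \<alpha>)) \<le> real (4 * card (nbrs w) * card (E 0))"
    by (rule of_nat_mono)
  then show ?thesis
    unfolding k_def[symmetric] by (simp add: energy_eq_card_pairs E_def)
qed

text \<open>A stopping rule: minimality makes the sets of words extending these disjoint and keeps
  their neighbour counts below 3 K when j > 0.\<close>

definition first_heavy :: "real \<Rightarrow> nat \<Rightarrow> int list set" where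
  "first_heavy K j = {w \<in> words j. K \<le> real (card (nbrs w)) \<and> (\<forall>i<j. real (card (nbrs (take i w))) < K)}"

lemma finite_first_heavy [simp]: "finite (first_heavy K j)"
  by (simp add: first_heavy_def)

text \<open>A word has at most one first heavy prefix, and if it has one it is good, because a heavy
  word is its own neighbour.\<close>

lemma sum_first_heavy_le:
  "(\<Sum>j\<le>N. card (first_heavy K j) * 3 ^ (N - j)) \<le> card (good_words K N)"
proof -
  define G where "G j = {\<alpha> \<in> words N. take j \<alpha> \<in> first_heavy K j}" for j
  have "G i \<inter> G j = {}" if "i < j" "j \<le> N" for i j
  proof (rule ccontr)
    assume "G i \<inter> G j \<noteq> {}"
    then obtain \<alpha> where \<alpha>: "take i \<alpha> \<in> first_heavy K i" "take j \<alpha> \<in> first_heavy K j"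
      by (auto simp: G_def)
    have "take i (take j \<alpha>) = take i \<alpha>" using that by (simp add: min_def)
    then show False using \<alpha> that by (auto simp: first_heavy_def)
  qed
  then have disj: "G i \<inter> G j = {}" if "i \<le> N" "j \<le> N" "i \<noteq> j" for i j
    using that by (metis inf_commute linorder_neqE_nat)
  have "(\<Sum>j\<le>N. card (first_heavy K j) * 3 ^ (N - j)) = (\<Sum>j\<le>N. card (G j))"
    unfolding G_def by (intro sum.cong refl card_words_prefix[symmetric]) (auto simp: first_heavy_def)
  also have "\<dots> = card (\<Union>j\<le>N. G j)"
    using disj by (intro card_UN_disjoint[symmetric]) (auto simp: G_def)
  also have "\<dots> \<le> card (good_words K N)"
  proof (intro card_mono UN_least subsetI)
    fix j \<alpha> assume "j \<in> {..N}" "\<alpha> \<in> G j"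
    then show "\<alpha> \<in> good_words K N"
      using self_nbrs by (auto simp: G_def first_heavy_def good_words_def)
  qed simp
  finally show ?thesis .
qed

text \<open>Strong induction. Words without a heavy prefix have fewer than K neighbours. The words
  extending one first heavy word of length j contribute at most 4 * 3K * 2K * 3^(n - j), and the
  total proportion of such words is at most 1 / (24 K), which adds another K.\<close>

lemma energy_le:
  fixes K :: real
  assumes K: "K > 1" and q: "24 * K * (card (good_words K N) / 3 ^ N) \<le> 1"
  shows "n \<le> N \<Longrightarrow> energy n \<le> 2 * K"
proof (induction n rule: less_induct)
  case (less n)
  have nonheavy: "real (card (nbrs \<alpha>)) \<le> K + (\<Sum>j\<le>n. if take j \<alpha> \<in> first_heavy K j then real (card (nbrs \<alpha>)) else 0)"
    if \<alpha>: "\<alpha> \<in> words n" for \<alpha>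
  proof (cases "card (nbrs \<alpha>) < K")
    case True
    moreover have "(\<Sum>j\<le>n. if take j \<alpha> \<in> first_heavy K j then real (card (nbrs \<alpha>)) else 0) \<ge> 0"
      by (intro sum_nonneg) simp
    ultimately show ?thesis by linarith
  next
    case False
    define j where "j = (LEAST j. K \<le> real (card (nbrs (take j \<alpha>))))"
    have heavy: "K \<le> card (nbrs (take n \<alpha>))" using False \<alpha> by (simp add: length_words)
    have jn: "j \<le> n" unfolding j_def using heavy by (rule Least_le)
    have "K \<le> card (nbrs (take j \<alpha>))" unfolding j_def using heavy by (rule LeastI)
    moreover have "card (nbrs (take i \<alpha>)) < K" if "i < j" for i
      using not_less_Least[OF that[unfolded j_def]] by simp
    ultimately have "take j \<alpha> \<in> first_heavy K j"
      using take_words[OF \<alpha> jn] by (simp add: first_heavy_def min_def)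
    then have "real (card (nbrs \<alpha>)) \<le> (\<Sum>j\<in>{j}. if take j \<alpha> \<in> first_heavy K j then real (card (nbrs \<alpha>)) else 0)"
      by simp
    also have "\<dots> \<le> (\<Sum>j\<le>n. if take j \<alpha> \<in> first_heavy K j then real (card (nbrs \<alpha>)) else 0)"
      using jn by (intro sum_mono2) auto
    finally show ?thesis using K by linarith
  qed
  have prefix: "(\<Sum>\<alpha>\<in>words n. if take j \<alpha> \<in> first_heavy K j then real (card (nbrs \<alpha>)) else 0)
     \<le> 24 * K\<^sup>2 * 3 ^ n * (card (first_heavy K j) * (1 / 3) ^ j)" if j: "j \<le> n" for j
  proof (cases j)
    \<comment> \<open>The empty word has one neighbour and K > 1, so it is not heavy. Hence j > 0 in
      the remaining case, where the induction hypothesis applies to n - j.\<close>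
    case 0
    then show ?thesis using K by (auto simp: first_heavy_def nbrs_Nil)
  next
    case (Suc i)
    have "(\<Sum>\<alpha>\<in>words n. if take j \<alpha> \<in> first_heavy K j then real (card (nbrs \<alpha>)) else 0) =
          (\<Sum>\<alpha>\<in>{\<alpha> \<in> words n. take j \<alpha> \<in> first_heavy K j}. real (card (nbrs \<alpha>)))"
      by (simp add: sum.If_cases Int_def)
    also have "{\<alpha> \<in> words n. take j \<alpha> \<in> first_heavy K j} = (\<Union>w\<in>first_heavy K j. {\<alpha> \<in> words n. take j \<alpha> = w})"
      by auto
    also have "(\<Sum>\<alpha>\<in>\<dots>. real (card (nbrs \<alpha>))) =
        (\<Sum>w\<in>first_heavy K j. \<Sum>\<alpha>\<in>{\<alpha> \<in> words n. take j \<alpha> = w}. real (card (nbrs \<alpha>)))"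
      by (intro sum.UNION_disjoint) auto
    also have "\<dots> \<le> (\<Sum>w\<in>first_heavy K j. 24 * K\<^sup>2 * 3 ^ (n - j))"
    proof (rule sum_mono)
      fix w assume w: "w \<in> first_heavy K j"
      then have wj: "w \<in> words (Suc i)" by (simp add: first_heavy_def Suc)
      have "card (nbrs (take i w)) < K" using w Suc by (auto simp: first_heavy_def)
      moreover have "real (card (nbrs w)) \<le> 3 * real (card (nbrs (take i w)))"
        using card_nbrs_Suc_le[OF wj] by linarith
      ultimately have c: "card (nbrs w) \<le> 3 * K" by linarith
      have e: "energy (n - j) \<le> 2 * K" using less j Suc by simp
      have "(\<Sum>\<alpha>\<in>{\<alpha> \<in> words n. take j \<alpha> = w}. real (card (nbrs \<alpha>)))
         \<le> 4 * card (nbrs w) * (3 ^ (n - j) * energy (n - j))"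
        using sum_card_nbrs_prefix_le[of w j n] wj j Suc by simp
      also have "\<dots> \<le> 4 * (3 * K) * (3 ^ (n - j) * (2 * K))"
        using c e K by (intro mult_mono) (auto simp: energy_def intro!: sum_nonneg divide_nonneg_nonneg)
      finally show "(\<Sum>\<alpha>\<in>{\<alpha> \<in> words n. take j \<alpha> = w}. real (card (nbrs \<alpha>))) \<le> 24 * K\<^sup>2 * 3 ^ (n - j)"
        by (simp add: power2_eq_square mult_ac)
    qed
    also have "\<dots> = 24 * K\<^sup>2 * 3 ^ n * (card (first_heavy K j) * (1 / 3) ^ j)"
      using j by (simp add: power_diff power_one_over)
    finally show ?thesis .
  qed
  have "(\<Sum>j\<le>n. card (first_heavy K j) * (1 / 3 :: real) ^ j) \<le> (\<Sum>j\<le>N. card (first_heavy K j) * (1 / 3) ^ j)"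
    using less.prems by (intro sum_mono2) auto
  also have "\<dots> = real (\<Sum>j\<le>N. card (first_heavy K j) * 3 ^ (N - j)) / 3 ^ N"
    unfolding of_nat_sum sum_divide_distrib
  proof (rule sum.cong[OF refl])
    fix j assume "j \<in> {..N}"
    then have "(3 :: real) ^ N = 3 ^ j * 3 ^ (N - j)" by (simp flip: power_add)
    then show "card (first_heavy K j) * (1 / 3 :: real) ^ j = real (card (first_heavy K j) * 3 ^ (N - j)) / 3 ^ N"
      by (simp add: power_one_over)
  qed
  also have "\<dots> \<le> card (good_words K N) / 3 ^ N"
    by (intro divide_right_mono of_nat_mono sum_first_heavy_le) simp
  finally have mass: "(\<Sum>j\<le>n. card (first_heavy K j) * (1 / 3 :: real) ^ j) \<le> card (good_words K N) / 3 ^ N" .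
  have "(\<Sum>\<alpha>\<in>words n. real (card (nbrs \<alpha>))) \<le>
     (\<Sum>\<alpha>\<in>words n. K + (\<Sum>j\<le>n. if take j \<alpha> \<in> first_heavy K j then real (card (nbrs \<alpha>)) else 0))"
    by (intro sum_mono nonheavy)
  also have "\<dots> = K * 3 ^ n + (\<Sum>j\<le>n. \<Sum>\<alpha>\<in>words n. if take j \<alpha> \<in> first_heavy K j then real (card (nbrs \<alpha>)) else 0)"
    by (subst sum.swap) (simp add: sum.distrib)
  also have "\<dots> \<le> K * 3 ^ n + (\<Sum>j\<le>n. 24 * K\<^sup>2 * 3 ^ n * (card (first_heavy K j) * (1 / 3) ^ j))"
    by (intro add_left_mono sum_mono prefix) simp
  also have "\<dots> = 3 ^ n * (K + K * (24 * K * (\<Sum>j\<le>n. card (first_heavy K j) * (1 / 3) ^ j)))"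
    by (simp add: sum_distrib_left power2_eq_square algebra_simps)
  also have "\<dots> \<le> 3 ^ n * (K + K * 1)"
  proof (intro mult_left_mono add_left_mono)
    have "24 * K * (\<Sum>j\<le>n. card (first_heavy K j) * (1 / 3 :: real) ^ j) \<le> 24 * K * (card (good_words K N) / 3 ^ N)"
      using mass K by (intro mult_left_mono) auto
    then show "24 * K * (\<Sum>j\<le>n. card (first_heavy K j) * (1 / 3) ^ j) \<le> 1" using q by linarith
  qed (use K in auto)
  finally show ?case by (simp add: energy_def pos_divide_le_eq mult.commute)
qed

section \<open>The Fourier side\<close>

definition \<phi> :: "real \<Rightarrow> complex" where
  "\<phi> y = (\<Sum>a\<in>digits. cis (y * d a)) / 3"

text \<open>The Fourier transform of the uniform measure on the values of words of length
  \<open>n\<close>; \<open>\<phi>\<close> is that of a single unscaled digit.\<close>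

definition \<nu> :: "nat \<Rightarrow> real \<Rightarrow> complex" where
  "\<nu> n y = (\<Sum>w\<in>words n. cis (y * val w)) / 3 ^ n"

text \<open>The Riesz product structure: prefix and suffix are chosen independently.\<close>

lemma \<nu>_add: "\<nu> (i + j) y = \<nu> i y * \<nu> j (y / 3 ^ i)"
proof -
  have "(\<Sum>w\<in>words (i + j). cis (y * val w)) = (\<Sum>p\<in>words i \<times> words j. cis (y * val (fst p @ snd p)))"
    unfolding words_add using inj_on_append_words
    by (subst sum.reindex) (auto simp: split_def o_def)
  also have "\<dots> = (\<Sum>u\<in>words i. \<Sum>v\<in>words j. cis (y * val (u @ v)))"
    by (simp add: sum.cartesian_product split_def)
  also have "\<dots> = (\<Sum>u\<in>words i. cis (y * val u)) * (\<Sum>v\<in>words j. cis (y / 3 ^ i * val v))"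
    unfolding sum_product
    by (intro sum.cong refl) (simp add: val_append length_words cis_mult power_one_over algebra_simps)
  finally show ?thesis by (simp add: \<nu>_def power_add)
qed

lemma \<nu>_0 [simp]: "\<nu> 0 y = 1"
  by (simp add: \<nu>_def)

lemma \<nu>_1: "\<nu> 1 y = \<phi> (y / 3)"
proof -
  have "words 1 = (\<lambda>a. [a]) ` digits"
    by (auto simp: words_def length_Suc_conv)
  then show ?thesis by (simp add: \<nu>_def \<phi>_def sum.reindex inj_on_def)
qed

lemma Re_\<phi>: "1 - Re (\<phi> y) = (\<Sum>a\<in>digits. 1 - cos (y * d a)) / 3"
  by (simp add: \<phi>_def sum_subtractf)

lemma one_minus_Re_\<phi>_triple_le: "1 - Re (\<phi> (3 * y)) \<le> 9 * (1 - Re (\<phi> y))"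
proof -
  have "(\<Sum>a\<in>digits. 1 - cos (3 * y * d a)) \<le> (\<Sum>a\<in>digits. 9 * (1 - cos (y * d a)))"
    using one_minus_cos_triple_le by (intro sum_mono) (simp add: mult.assoc)
  then show ?thesis unfolding Re_\<phi> by (simp add: sum_distrib_left)
qed

lemma one_minus_Re_\<phi>_le_2: "1 - Re (\<phi> y) \<le> 2"
proof -
  have "1 - cos (y * d a) \<le> 2" for a
    using cos_ge_minus_one[of "y * d a"] by linarith
  then have "(\<Sum>a\<in>digits. 1 - cos (y * d a)) \<le> (\<Sum>a\<in>digits. 2)"
    by (intro sum_mono)
  then show ?thesis unfolding Re_\<phi> by simp
qed

text \<open>All values lie in [-1/2, 1/2], so at frequencies up to 1 there is no cancellation. This
  controls the tail of the product.\<close>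

lemma cmod_\<nu>_ge:
  assumes "\<bar>y\<bar> \<le> 1"
  shows "7 / 8 \<le> cmod (\<nu> n y)"
proof -
  have "7 / 8 \<le> cos (y * val w)" if "w \<in> words n" for w
  proof -
    have "(0::real) \<le> (1 / 3) ^ n" by simp
    then have "\<bar>val w\<bar> \<le> 1 / 2" using abs_val_le[OF that] by argo
    then have "\<bar>y\<bar> * \<bar>val w\<bar> \<le> 1 * (1 / 2)" using assms by (intro mult_mono) auto
    then show ?thesis using cos_ge[of "y * val w" "1 / 2"] by (simp add: abs_mult power2_eq_square)
  qed
  then have "(\<Sum>w\<in>words n. 7 / 8) \<le> (\<Sum>w\<in>words n. cos (y * val w))" by (intro sum_mono)
  then have "7 / 8 \<le> (\<Sum>w\<in>words n. cos (y * val w)) / 3 ^ n" by (simp add: field_simps)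
  also have "\<dots> = Re (\<nu> n y)"
    by (simp add: \<nu>_def Re_divide_of_real[of _ "3 ^ n", simplified])
  also have "\<dots> \<le> cmod (\<nu> n y)" by (rule complex_Re_le_cmod)
  finally show ?thesis .
qed

lemma cmod_\<phi>_ge:
  assumes "\<bar>y\<bar> \<le> 1"
  shows "1 / 2 \<le> cmod (\<phi> y)"
proof -
  have "1 / 2 \<le> cos (y * d a)" if "a \<in> digits" for a
  proof -
    have "\<bar>y\<bar> * \<bar>d a\<bar> \<le> 1 * 1" using assms abs_d_le[OF that] by (intro mult_mono) auto
    then show ?thesis using cos_ge[of "y * d a" "1"] by (simp add: abs_mult)
  qed
  then have "(\<Sum>a\<in>digits. 1 / 2) \<le> (\<Sum>a\<in>digits. cos (y * d a))" by (intro sum_mono)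
  then have "1 / 2 \<le> Re (\<phi> y)" by (simp add: \<phi>_def)
  then show ?thesis using complex_Re_le_cmod[of "\<phi> y"] by linarith
qed

section \<open>Mean-square bounds for the transform\<close>

lemma continuous_on_\<nu>: "continuous_on S (\<nu> n)"
  unfolding \<nu>_def by (intro continuous_intros) auto

lemma integrable_\<nu>_square: "(\<lambda>y. (cmod (\<nu> n y))\<^sup>2) integrable_on {a..b}"
  by (intro integrable_continuous_interval continuous_intros continuous_on_\<nu>)

lemma cmod_\<nu>_square:
  "(cmod (\<nu> n y))\<^sup>2 = (cmod (\<Sum>w\<in>words n. cis (y * val w)))\<^sup>2 / 9 ^ n"
proof -
  have "((3 :: real) ^ n)\<^sup>2 = 9 ^ n" by (simp add: power2_eq_square flip: power_mult_distrib)
  then show ?thesis by (simp add: \<nu>_def norm_divide norm_power power_divide)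
qed

lemma has_integral_fejer_\<nu>:
  assumes "R > 0"
  shows "((\<lambda>y. (1 - y / R) * (cmod (\<nu> n y))\<^sup>2) has_integral
     (\<Sum>u\<in>words n. \<Sum>w\<in>words n. fejer R (val u - val w)) / 9 ^ n) {0..R}"
  using has_integral_divide[OF has_integral_fejer_sum[where A = "words n" and x = val, OF finite_words assms], of "9 ^ n"]
  by (simp add: cmod_\<nu>_square)

lemma integral_\<nu>_le_energy: "integral {0..3 ^ n} (\<lambda>y. (cmod (\<nu> n y))\<^sup>2) \<le> 8 * energy n"
proof -
  \<comment> \<open>With this \<open>R\<close> the triangular weight is at least 1/2 on [0, 3^n],
    and 4 / R is exactly the neighbour distance.\<close>
  define R :: real where "R = 2 * 3 ^ n"
  define F where "F = (\<Sum>u\<in>words n. \<Sum>w\<in>words n. fejer R (val u - val w))"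
  have R: "R > 0" by (simp add: R_def)
  have I: "((\<lambda>y. (1 - y / R) * (cmod (\<nu> n y))\<^sup>2) has_integral F / 9 ^ n) {0..R}"
    unfolding F_def using R by (rule has_integral_fejer_\<nu>)
  have "integral {0..3 ^ n} (\<lambda>y. 1 / 2 * (cmod (\<nu> n y))\<^sup>2) \<le> integral {0..3 ^ n} (\<lambda>y. (1 - y / R) * (cmod (\<nu> n y))\<^sup>2)"
    by (intro integral_le integrable_continuous_interval continuous_intros continuous_on_\<nu> mult_right_mono)
      (auto simp: R_def field_simps)
  also have "\<dots> \<le> integral {0..R} (\<lambda>y. (1 - y / R) * (cmod (\<nu> n y))\<^sup>2)"
    by (intro integral_subset_le integrable_continuous_interval continuous_intros continuous_on_\<nu>)
      (auto simp: R_def intro!: mult_nonneg_nonneg)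
  also have "\<dots> = F / 9 ^ n" using I by (rule integral_unique)
  also have "\<dots> \<le> (2 * R * card {(u, w) \<in> words n \<times> words n. \<bar>val u - val w\<bar> \<le> 4 / R}) / 9 ^ n"
    unfolding F_def using R by (intro divide_right_mono fejer_sum_le) auto
  also have "\<dots> = 2 * R * (3 ^ n * energy n) / 9 ^ n"
    unfolding energy_eq_card_pairs by (simp add: R_def power_one_over)
  also have "\<dots> = 4 * energy n"
  proof -
    have "(9 :: real) ^ n = 3 ^ n * 3 ^ n" by (simp flip: power_mult_distrib)
    then show ?thesis by (simp add: R_def)
  qed
  finally show ?thesis by simp
qed

text \<open>Only the diagonal of the Fejer sum is kept: 3^n terms of size R/2, divided by
  9^n.\<close>

lemma integral_\<nu>_ge: "3 ^ m / 2 \<le> integral {0..3 ^ (n + m)} (\<lambda>y. (cmod (\<nu> n y))\<^sup>2)"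
proof -
  define R :: real where "R = 3 ^ (n + m)"
  define F where "F = (\<Sum>u\<in>words n. \<Sum>w\<in>words n. fejer R (val u - val w))"
  have R: "R > 0" by (simp add: R_def)
  have I: "((\<lambda>y. (1 - y / R) * (cmod (\<nu> n y))\<^sup>2) has_integral F / 9 ^ n) {0..R}"
    unfolding F_def using R by (rule has_integral_fejer_\<nu>)
  have "(\<Sum>u\<in>words n. R / 2) \<le> F"
    unfolding F_def
  proof (rule sum_mono)
    fix u assume u: "u \<in> words n"
    have "R / 2 = (\<Sum>w\<in>{u}. fejer R (val u - val w))" by (simp add: fejer_def)
    also have "\<dots> \<le> (\<Sum>w\<in>words n. fejer R (val u - val w))"
      using u R by (intro sum_mono2) (auto simp: fejer_nonneg)
    finally show "R / 2 \<le> (\<Sum>w\<in>words n. fejer R (val u - val w))" .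
  qed
  then have "3 ^ n * (R / 2) / 9 ^ n \<le> F / 9 ^ n" by (intro divide_right_mono) simp_all
  moreover have "3 ^ n * (R / 2) / 9 ^ n = 3 ^ m / 2"
  proof -
    have "(9 :: real) ^ n = 3 ^ n * 3 ^ n" by (simp flip: power_mult_distrib)
    then show ?thesis by (simp add: R_def power_add)
  qed
  moreover have "F / 9 ^ n = integral {0..R} (\<lambda>y. (1 - y / R) * (cmod (\<nu> n y))\<^sup>2)"
    using I by (rule integral_unique[symmetric])
  moreover have "\<dots> \<le> integral {0..R} (\<lambda>y. (cmod (\<nu> n y))\<^sup>2)"
    using R by (intro integral_le integrable_\<nu>_square integrable_continuous_interval continuous_intros continuous_on_\<nu>)
      (auto intro!: mult_left_le_one_le)
  ultimately show ?thesis by (simp add: R_def)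
qed

end

section \<open>Digit systems with sum zero\<close>

locale balanced_digit_system = digit_system +
  assumes d_sum: "d (-1) + d 0 + d 1 = 0"
begin

text \<open>The three unit numbers in \<^term>\<open>\<phi> y\<close> have product 1, so the factorisation of
  \<open>a\<^sup>3 + b\<^sup>3 + c\<^sup>3 - 3 a b c\<close> shows that \<^term>\<open>\<phi> (3 * y)\<close> is near 1 wherever \<^term>\<open>\<phi> y\<close> is near 0.\<close>

lemma one_minus_Re_\<phi>_triple_le_cmod: "1 - Re (\<phi> (3 * y)) \<le> 6 * cmod (\<phi> y)"
proof -
  define a where "a = cis (y * d (-1))"
  define b where "b = cis (y * d 0)"
  define c where "c = cis (y * d 1)"
  have abc: "a * b * c = 1"
    using d_sum by (simp add: a_def b_def c_def cis_mult flip: distrib_left)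
  have n: "cmod a = 1" "cmod b = 1" "cmod c = 1" by (simp_all add: a_def b_def c_def)
  have p: "\<phi> y = (a + b + c) / 3" by (simp add: \<phi>_def digits_def a_def b_def c_def)
  have "\<phi> (3 * y) = (a ^ 3 + b ^ 3 + c ^ 3) / 3"
    by (simp add: \<phi>_def digits_def a_def b_def c_def Complex.DeMoivre mult.assoc)
  moreover have "a ^ 3 + b ^ 3 + c ^ 3 = 3 + (a + b + c) * (a * a + b * b + c * c - a * b - b * c - c * a)"
    using abc by (simp add: power3_eq_cube) algebra
  ultimately have "\<phi> (3 * y) - 1 = \<phi> y * (a * a + b * b + c * c - a * b - b * c - c * a)"
    unfolding p by simp
  then have "cmod (\<phi> (3 * y) - 1) = cmod (\<phi> y) * cmod (a * a + b * b + c * c - a * b - b * c - c * a)"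
    by (simp add: norm_mult)
  also have "\<dots> \<le> cmod (\<phi> y) * 6"
  proof (rule mult_left_mono)
    have "cmod (a * a + b * b + c * c - a * b - b * c - c * a) \<le>
        cmod (a * a) + cmod (b * b) + cmod (c * c) + cmod (a * b) + cmod (b * c) + cmod (c * a)"
      by (intro order_trans[OF norm_triangle_ineq4] add_right_mono order_trans[OF norm_triangle_ineq] order_refl)
    then show "cmod (a * a + b * b + c * c - a * b - b * c - c * a) \<le> 6"
      by (simp add: norm_mult n)
  qed simp
  finally show ?thesis using abs_Re_le_cmod[of "\<phi> (3 * y) - 1"] by simp
qed

lemma cmod_\<nu>_ge_power:
  assumes "0 < \<rho>" "\<rho> \<le> 1" "0 \<le> z" "\<And>y. 0 \<le> y \<Longrightarrow> y \<le> z \<Longrightarrow> \<rho> \<le> cmod (\<phi> y)"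
  shows "\<rho> / 18 ^ m \<le> cmod (\<nu> m z)"
proof -
  \<comment> \<open>The second conjunct lets a factor near a zero of \<^term>\<open>\<phi>\<close> be paid for by the factors that
    follow: \<open>1 - Re \<phi>\<close> is small right after such a factor and then grows at most ninefold per step.\<close>
  have "\<rho> / 18 ^ m \<le> cmod (\<nu> m z) \<and> (1 - Re (\<phi> z)) / (2 * 18 ^ m) \<le> cmod (\<nu> m z)"
    using assms(3,4)
  proof (induction m arbitrary: z)
    case 0
    then show ?case using assms(2) one_minus_Re_\<phi>_le_2[of z] by simp
  next
    case (Suc m)
    define x where "x = z / 3"
    define s where "s = 1 - Re (\<phi> x)"
    have z: "z = 3 * x" "0 \<le> x" "x \<le> z" using Suc.prems(1) by (auto simp: x_def)
    have IH: "\<rho> / 18 ^ m \<le> cmod (\<nu> m x)" "s / (2 * 18 ^ m) \<le> cmod (\<nu> m x)"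
      using Suc.IH[of x] Suc.prems z by (auto simp: s_def)
    have \<phi>\<rho>: "\<rho> \<le> cmod (\<phi> x)" using Suc.prems z by auto
    have \<nu>: "cmod (\<nu> (Suc m) z) = cmod (\<phi> x) * cmod (\<nu> m x)"
      using \<nu>_add[of 1 m z] \<nu>_1[of z] by (simp add: x_def norm_mult)
    have s9: "1 - Re (\<phi> z) \<le> 9 * s" and s6: "1 - Re (\<phi> z) \<le> 6 * cmod (\<phi> x)"
      using one_minus_Re_\<phi>_triple_le[of x] one_minus_Re_\<phi>_triple_le_cmod[of x] by (simp_all add: z s_def)
    show ?case
    \<comment> \<open>If s <= 1/2, the new factor is at least 1/2 and both bounds lose at most 18 =
      2 * 9. Otherwise the second bound at \<open>x\<close> is at least 1 / (4 * 18^m), so only the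
      factor |phi x| is lost, and this is at least \<open>\<rho>\<close> and at least (1 - Re (phi
      z)) / 6.\<close>
    proof (cases "s \<le> 1 / 2")
      case True
      then have h: "1 / 2 \<le> cmod (\<phi> x)" using complex_Re_le_cmod[of "\<phi> x"] by (simp add: s_def)
      then have half: "1 / 2 * cmod (\<nu> m x) \<le> cmod (\<nu> (Suc m) z)"
        unfolding \<nu> by (intro mult_right_mono) auto
      have "\<rho> / 18 ^ Suc m \<le> 1 / 2 * (\<rho> / 18 ^ m)" using assms(1) by (simp add: field_simps)
      moreover have "(1 - Re (\<phi> z)) / (2 * 18 ^ Suc m) \<le> 9 * s / (2 * 18 ^ Suc m)"
        using s9 by (intro divide_right_mono) auto
      moreover have "9 * s / (2 * 18 ^ Suc m) = 1 / 2 * (s / (2 * 18 ^ m))" by simp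
      ultimately show ?thesis using half IH by linarith
    next
      case False
      then have "1 / 4 / 18 ^ m \<le> s / (2 * 18 ^ m)" by (simp add: field_simps)
      then have "1 / 4 / 18 ^ m \<le> cmod (\<nu> m x)" using IH by linarith
      then have q: "cmod (\<phi> x) * (1 / 4 / 18 ^ m) \<le> cmod (\<nu> (Suc m) z)"
        unfolding \<nu> by (intro mult_left_mono) auto
      have "\<rho> / 18 ^ Suc m \<le> \<rho> * (1 / 4 / 18 ^ m)" using assms(1) by (simp add: field_simps)
      also have "\<dots> \<le> cmod (\<phi> x) * (1 / 4 / 18 ^ m)" using \<phi>\<rho> by (intro mult_right_mono) auto
      finally have 1: "\<rho> / 18 ^ Suc m \<le> cmod (\<nu> (Suc m) z)" using q by linarith
      have "(1 - Re (\<phi> z)) / (2 * 18 ^ Suc m) \<le> 6 * cmod (\<phi> x) / (2 * 18 ^ Suc m)"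
        using s6 by (intro divide_right_mono) auto
      also have "\<dots> \<le> cmod (\<phi> x) * (1 / 4 / 18 ^ m)" by (simp add: field_simps)
      finally show ?thesis using 1 q by linarith
    qed
  qed
  then show ?thesis ..
qed

text \<open>Between 3^(im) and 3^((i+1)m) the transform of length im has mean square at least 3^m /
  2 - 16 K, by the diagonal bound minus the energy bound. Passing to length I m costs the factor
  \<open>\<kappa>\<close>. The I blocks together stay below the energy bound at length I m.\<close>

lemma scale_count_le:
  assumes \<rho>: "0 < \<rho>" "\<rho> \<le> 1" and \<phi>: "\<And>y. 0 \<le> y \<Longrightarrow> y \<le> 3 ^ m \<Longrightarrow> \<rho> \<le> cmod (\<phi> y)"
    and E: "\<And>n. n \<le> I * m \<Longrightarrow> energy n \<le> 2 * K"
  shows "I * (49 / 64 * (\<rho> / 18 ^ m)\<^sup>2 * (3 ^ m / 2 - 16 * K)) \<le> 16 * K"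
proof -
  define N where "N = I * m"
  \<comment> \<open>The square of 7/8, from the tail of the product, times the square of the bound
    for the m middle factors.\<close>
  define \<kappa> where "\<kappa> = 49 / 64 * (\<rho> / 18 ^ m)\<^sup>2"
  define g where "g n y = (cmod (\<nu> n y))\<^sup>2" for n y
  have int: "g n integrable_on {a..b}" for n a b
    unfolding g_def by (rule integrable_\<nu>_square)
  have step: "\<kappa> * (3 ^ m / 2 - 16 * K) \<le> integral {3 ^ (i * m)..3 ^ (Suc i * m)} (g N)" if i: "Suc i \<le> I" for i
  proof -
    define n where "n = i * m"
    have nN: "n + m \<le> N" using mult_le_mono1[OF i, of m] by (simp add: n_def N_def)
    have "3 ^ m / 2 \<le> integral {0..3 ^ (n + m)} (g n)"
      unfolding g_def by (rule integral_\<nu>_ge)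
    also have "\<dots> = integral {0..3 ^ n} (g n) + integral {3 ^ n..3 ^ (n + m)} (g n)"
      by (rule Henstock_Kurzweil_Integration.integral_combine[symmetric]) (auto simp: int power_increasing)
    also have "integral {0..3 ^ n} (g n) \<le> 16 * K"
      using integral_\<nu>_le_energy[of n] E[of n] nN unfolding g_def N_def by linarith
    finally have "3 ^ m / 2 - 16 * K \<le> integral {3 ^ n..3 ^ (n + m)} (g n)" by simp
    then have "\<kappa> * (3 ^ m / 2 - 16 * K) \<le> \<kappa> * integral {3 ^ n..3 ^ (n + m)} (g n)"
      using \<rho> by (intro mult_left_mono) (auto simp: \<kappa>_def)
    also have "\<dots> = integral {3 ^ n..3 ^ (n + m)} (\<lambda>y. \<kappa> * g n y)" by simp
    also have "\<dots> \<le> integral {3 ^ n..3 ^ (n + m)} (g N)"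
    proof (rule integral_le)
      fix y :: real assume y: "y \<in> {3 ^ n..3 ^ (n + m)}"
      have y0: "0 \<le> y" using y by (auto intro: order_trans[rotated])
      \<comment> \<open>Three groups of factors: the first n, the m critical ones, and a tail whose
        argument y / 3^(n+m) is at most 1.\<close>
      have "\<nu> N y = \<nu> n y * (\<nu> m (y / 3 ^ n) * \<nu> (N - (n + m)) (y / 3 ^ n / 3 ^ m))"
        using \<nu>_add[of n "m + (N - (n + m))" y] \<nu>_add[of m "N - (n + m)" "y / 3 ^ n"] nN by simp
      then have eq: "cmod (\<nu> N y) = cmod (\<nu> n y) * (cmod (\<nu> m (y / 3 ^ n)) * cmod (\<nu> (N - (n + m)) (y / 3 ^ n / 3 ^ m)))"
        by (simp add: norm_mult)
      have "\<rho> / 18 ^ m \<le> cmod (\<nu> m (y / 3 ^ n))"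
      proof (rule cmod_\<nu>_ge_power[OF \<rho>])
        show "\<rho> \<le> cmod (\<phi> x)" if "0 \<le> x" "x \<le> y / 3 ^ n" for x
        proof (rule \<phi>)
          have "y / 3 ^ n \<le> 3 ^ (n + m) / 3 ^ n" using y by (intro divide_right_mono) auto
          then have "x \<le> 3 ^ (n + m) / 3 ^ n" using that by linarith
          then show "x \<le> 3 ^ m" by (simp add: power_add)
        qed (use that in simp)
      qed (use y0 in simp)
      moreover have "7 / 8 \<le> cmod (\<nu> (N - (n + m)) (y / 3 ^ n / 3 ^ m))"
        using y y0 by (intro cmod_\<nu>_ge) (auto simp: power_add field_simps)
      ultimately have "cmod (\<nu> n y) * ((\<rho> / 18 ^ m) * (7 / 8)) \<le> cmod (\<nu> N y)"
        unfolding eq using \<rho> by (intro mult_left_mono mult_mono) auto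
      then have "(cmod (\<nu> n y) * ((\<rho> / 18 ^ m) * (7 / 8)))\<^sup>2 \<le> (cmod (\<nu> N y))\<^sup>2"
        using \<rho> by (intro power_mono) auto
      then show "\<kappa> * g n y \<le> g N y"
        by (simp add: \<kappa>_def g_def power_mult_distrib power_divide algebra_simps)
    qed (auto intro!: integrable_on_mult_right int)
    finally show ?thesis by (simp add: n_def add.commute)
  qed
  have "i * (\<kappa> * (3 ^ m / 2 - 16 * K)) \<le> integral {0..3 ^ (i * m)} (g N)" if "i \<le> I" for i
    using that
  proof (induction i)
    case 0
    show ?case by (simp, rule integral_nonneg) (auto simp: int, simp add: g_def)
  next
    case (Suc i)
    have "integral {0..3 ^ (Suc i * m)} (g N) = integral {0..3 ^ (i * m)} (g N) + integral {3 ^ (i * m)..3 ^ (Suc i * m)} (g N)"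
      by (rule Henstock_Kurzweil_Integration.integral_combine[symmetric]) (auto simp: int intro!: power_increasing)
    then show ?case using Suc step[OF Suc.prems] by (simp add: algebra_simps)
  qed
  then have "I * (\<kappa> * (3 ^ m / 2 - 16 * K)) \<le> integral {0..3 ^ N} (g N)" by (simp add: N_def)
  also have "\<dots> \<le> 16 * K"
    using integral_\<nu>_le_energy[of N] E[of N] unfolding g_def N_def by simp
  finally show ?thesis by (simp add: \<kappa>_def)
qed

text \<open>First the proportion \<open>q\<close> of good words is shown to exceed 1 / (24 K), by
  contradiction with the block count; then 9^m rounds of the covering recursion make the excess
  negligible.\<close>

lemma measure_shadow_le:
  fixes m :: nat
  assumes m: "4 \<le> m" and \<phi>: "\<And>y. 0 \<le> y \<Longrightarrow> y \<le> 3 ^ m \<Longrightarrow> 1 / 81 ^ m \<le> cmod (\<phi> y)"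
  shows "measure lebesgue (shadow (9 ^ m * (2 * 1458 ^ (2 * m) * m))) \<le> 2561 / 3 ^ m"
proof -
  \<comment> \<open>Chosen so that 16 K = 3^m / 4, half of the diagonal bound; m >= 4 ensures K >
    1.\<close>
  define K :: real where "K = 3 ^ m / 64"
  \<comment> \<open>As 1458 = 81 * 18, the number 2 * 1458^(2m) of blocks times the loss per block
    is 49/32 > 1.\<close>
  define N where "N = 2 * 1458 ^ (2 * m) * m"
  define q where "q = card (good_words K N) / 3 ^ N"
  have "(3::real) ^ 4 \<le> 3 ^ m" using m by (intro power_increasing) auto
  then have K: "K > 1" by (simp add: K_def)
  have q: "24 * K * q > 1"
  proof (rule ccontr)
    assume "\<not> 24 * K * q > 1"
    then have "energy n \<le> 2 * K" if "n \<le> 2 * 1458 ^ (2 * m) * m" for n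
      using energy_le[OF K, of N n] that by (simp add: q_def N_def)
    then have "real (2 * 1458 ^ (2 * m)) * (49 / 64 * (1 / 81 ^ m / 18 ^ m)\<^sup>2 * (3 ^ m / 2 - 16 * K)) \<le> 16 * K"
      by (intro scale_count_le \<phi>) (auto simp: power_le_one)
    moreover have "(1 / 81 ^ m / 18 ^ m :: real)\<^sup>2 = 1 / 1458 ^ (2 * m)"
      by (simp add: power_divide flip: power_mult_distrib) (simp add: power_mult mult.commute)
    ultimately have "49 / 32 * (3 ^ m / 2 - 16 * K) \<le> 16 * K" by simp
    then show False by (simp add: K_def)
  qed
  have "real (card (good_words K N)) \<le> real (3 ^ N)"
    using card_mono[OF finite_words good_words_subset, of K N] by (simp only: card_words of_nat_le_iff)
  then have q1: "0 \<le> q" "q \<le> 1" by (simp_all add: q_def)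
  define r where "r = (9::nat) ^ m"
  \<comment> \<open>Bernoulli and (1 - q)(1 + q) <= 1 give (1 - q)^r <= 1 / (1 + r q), and r q > 9^m
    / (24 K).\<close>
  have "(1 - q) ^ r * (1 + r * q) \<le> (1 - q) ^ r * (1 + q) ^ r"
    using q1 Bernoulli_inequality[of q r] by (intro mult_left_mono) auto
  also have "\<dots> = (1 - q\<^sup>2) ^ r"
    by (simp add: power2_eq_square algebra_simps flip: power_mult_distrib)
  also have "\<dots> \<le> 1" using q1 by (intro power_le_one) (auto simp: power_le_one)
  finally have B: "(1 - q) ^ r * (1 + r * q) \<le> 1" .
  have "(1 - q) ^ r * (r * q) \<le> (1 - q) ^ r * (1 + r * q)" using q1 by (intro mult_left_mono) auto
  then have "(1 - q) ^ r * (r * q) \<le> 1" using B by linarith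
  then have "(1 - q) ^ r * (r * q) * (24 * K) \<le> 1 * (24 * K)" using K by (intro mult_right_mono) auto
  moreover have "(1 - q) ^ r * r * 1 \<le> (1 - q) ^ r * r * (24 * K * q)"
    using q q1 by (intro mult_left_mono) auto
  ultimately have "(1 - q) ^ r * r \<le> 24 * K" by (simp add: mult_ac)
  moreover have "real r = 3 ^ m * 3 ^ m" by (simp add: r_def flip: power_mult_distrib)
  ultimately have "(1 - q) ^ r \<le> (24 / 64) / 3 ^ m" by (simp add: K_def field_simps)
  moreover have "measure lebesgue (shadow (r * N)) \<le> 40 / K + 2 * (1 - q) ^ r"
    unfolding q_def using K by (intro measure_shadow_mult_le) simp
  moreover have "40 / K = 2560 / 3 ^ m" by (simp add: K_def)
  ultimately have "measure lebesgue (shadow (r * N)) \<le> 2560 / 3 ^ m + 1 / 3 ^ m"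
    by (simp add: field_simps)
  then show ?thesis by (simp add: r_def N_def)
qed

text \<open>The three exponentials have product 1 and sum of modulus at most 3
  \<open>\<rho>\<close>, so their cubes are within 6 \<open>\<rho>\<close> of 1; that distance is 2
  |sin (pi t)|.\<close>

lemma near_integer_of_small_\<phi>:
  assumes \<phi>: "cmod (\<phi> x) \<le> \<rho>" and a: "a \<in> digits"
  defines "t \<equiv> 3 * x / (2 * pi) * d a"
  shows "\<bar>t - of_int (round t)\<bar> \<le> 3 * \<rho>"
proof -
  define z where "z a = cis (x * d a)" for a
  have p: "z (-1) * z 0 * z 1 = 1"
    using d_sum by (simp add: z_def cis_mult flip: distrib_left)
  have n: "cmod (z b) = 1" for b by (simp add: z_def)
  have sum: "cmod (z (-1) + z 0 + z 1) = 3 * cmod (\<phi> x)"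
    by (simp add: \<phi>_def z_def digits_def norm_divide add.assoc)
  have "cmod (z a ^ 3 - 1) \<le> 2 * cmod (z (-1) + z 0 + z 1)"
    using a p cmod_cube_minus_one_le[of "z (-1)" "z 0" "z 1"]
      cmod_cube_minus_one_le[of "z 0" "z 1" "z (-1)"] cmod_cube_minus_one_le[of "z 1" "z (-1)" "z 0"]
    by (auto simp: digits_def n mult_ac add_ac)
  moreover have "z a ^ 3 = cis (3 * (x * d a))"
    by (simp add: z_def Complex.DeMoivre)
  ultimately have "\<bar>sin (3 * (x * d a) / 2)\<bar> \<le> 3 * \<rho>"
    using \<phi> by (simp add: sum cmod_cis_minus_one)
  moreover have "3 * (x * d a) / 2 = pi * t" by (simp add: t_def)
  ultimately show ?thesis using abs_sin_ge_round[of t] by (metis order_trans)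
qed

end

section \<open>Directions and the exceptional set\<close>

text \<open>The projection of the unit vector with label \<open>a\<close> onto the direction
  \<open>\<theta>\<close>.\<close>

definition dir :: "real \<Rightarrow> int \<Rightarrow> real" where
  "dir \<theta> a = cos (pi * (1 / 2 + 2 / 3 * of_int a) - \<theta>)"

lemma dir_0: "dir \<theta> 0 = sin \<theta>"
  by (simp add: dir_def cos_diff)

lemma dir_1: "dir \<theta> 1 = - (sqrt 3 / 2) * cos \<theta> - sin \<theta> / 2"
proof -
  have "pi * (1 / 2 + 2 / 3 * of_int 1) - \<theta> = pi + (pi / 6 - \<theta>)" by simp
  then have "dir \<theta> 1 = - cos (pi / 6 - \<theta>)" unfolding dir_def by (simp only: cos_periodic_pi2)
  then show ?thesis by (simp add: cos_diff cos_30 sin_30)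
qed

lemma dir_minus_1: "dir \<theta> (-1) = sqrt 3 / 2 * cos \<theta> - sin \<theta> / 2"
proof -
  have "pi * (1 / 2 + 2 / 3 * of_int (-1)) - \<theta> = - (pi / 6 + \<theta>)" by (simp add: algebra_simps)
  then have "dir \<theta> (-1) = cos (pi / 6 + \<theta>)" unfolding dir_def by (simp only: cos_minus)
  then show ?thesis by (simp add: cos_add cos_30 sin_30)
qed

interpretation dir: balanced_digit_system "dir \<theta>" for \<theta>
  by unfold_locales (simp_all add: dir_0 dir_1 dir_minus_1, simp add: dir_def)

text \<open>The Eisenstein lattice point j + i exp(pi sqrt(-1) / 3). Its argument determines the
  directions in which the first two projections of \<open>dir\<close> (labels 0 and 1) are
  proportional to i and j.\<close>

definition slope :: "int \<Rightarrow> int \<Rightarrow> complex" where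
  "slope i j = Complex (of_int j + of_int i / 2) (sqrt 3 / 2 * of_int i)"

text \<open>The squared modulus i^2 + ij + j^2 is a positive integer.\<close>

lemma cmod_slope_ge:
  assumes "(i, j) \<noteq> (0, 0)"
  shows "1 \<le> cmod (slope i j)"
proof -
  have "(cmod (slope i j))\<^sup>2 = of_int (i * i + i * j + j * j)"
    unfolding cmod_power2 by (simp add: slope_def power2_eq_square algebra_simps)
  moreover have "1 \<le> i * i + i * j + j * j"
  proof -
    have "2 * (i * i + i * j + j * j) = i * i + j * j + (i + j) * (i + j)" by (simp add: algebra_simps)
    moreover have "i * i + j * j + (i + j) * (i + j) > 0"
      by (rule add_pos_nonneg) (use assms in \<open>auto simp: sum_squares_gt_zero_iff\<close>)
    ultimately show ?thesis by simp
  qed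
  ultimately have "1\<^sup>2 \<le> (cmod (slope i j))\<^sup>2" by (simp del: of_int_add of_int_mult)
  then show ?thesis by (rule power2_le_imp_le) simp
qed

lemma slope_sin: "of_int j * dir \<theta> 0 - of_int i * dir \<theta> 1 = cmod (slope i j) * sin (\<theta> + Arg (slope i j))"
proof -
  have "Re (slope i j) = cmod (slope i j) * cos (Arg (slope i j))"
    "Im (slope i j) = cmod (slope i j) * sin (Arg (slope i j))"
    using Re_rcis[of "cmod (slope i j)" "Arg (slope i j)"] Im_rcis[of "cmod (slope i j)" "Arg (slope i j)"]
    unfolding rcis_cmod_Arg by auto
  then show ?thesis by (simp add: slope_def dir_0 dir_1 sin_add algebra_simps)
qed

text \<open>Neighbourhoods of the zeros of sin (\<open>\<theta>\<close> + Arg (slope i j)). Since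
  \<open>\<theta>\<close> runs over [0, pi] and Arg over (-pi, pi], multiples of pi from -1 to 2
  suffice.\<close>

definition exceptional :: "nat \<Rightarrow> real \<Rightarrow> real set" where
  "exceptional M \<rho> = (\<Union>(i, j)\<in>{-int M..int M} \<times> {-int M..int M}. \<Union>k\<in>{-1..2}.
     cball (of_int k * pi - Arg (slope i j)) (16 * pi * M * \<rho>))"

lemma exceptional_lmeasurable: "exceptional M \<rho> \<in> lmeasurable"
  unfolding exceptional_def by (intro fmeasurable.finite_UN) auto

lemma measure_exceptional_le:
  assumes "M \<ge> 1" "\<rho> \<ge> 0"
  shows "measure lebesgue (exceptional M \<rho>) \<le> 4608 * real M ^ 3 * \<rho>"
proof -
  define r where "r = 16 * pi * M * \<rho>"
  have r: "0 \<le> r" using assms by (simp add: r_def)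
  have b: "measure lebesgue (cball (c::real) r) = 2 * r" for c
    using r by (simp add: cball_eq_atLeastAtMost)
  have U: "measure lebesgue (\<Union>k\<in>{-1..2::int}. cball (of_int k * pi - x) r) \<le> 8 * r" for x
  proof -
    have "measure lebesgue (\<Union>k\<in>{-1..2::int}. cball (of_int k * pi - x) r) \<le>
       (\<Sum>k\<in>{-1..2::int}. measure lebesgue (cball (of_int k * pi - x) r))"
      by (intro measure_UNION_le) auto
    then show ?thesis by (simp only: b) simp
  qed
  have "measure lebesgue (exceptional M \<rho>) \<le>
    (\<Sum>p\<in>{-int M..int M} \<times> {-int M..int M}. measure lebesgue (\<Union>k\<in>{-1..2}. cball (of_int k * pi - Arg (slope (fst p) (snd p))) r))"
    unfolding exceptional_def split_def r_def by (intro measure_UNION_le) auto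
  also have "\<dots> \<le> (\<Sum>p\<in>{-int M..int M} \<times> {-int M..int M}. 8 * r)"
    by (intro sum_mono U)
  also have "\<dots> = (2 * real M + 1)\<^sup>2 * (8 * r)"
    by (simp add: card_cartesian_product power2_eq_square nat_add_distrib nat_mult_distrib algebra_simps)
  also have "\<dots> \<le> (3 * real M)\<^sup>2 * (8 * (16 * 4 * M * \<rho>))"
  proof (rule mult_mono)
    show "(2 * real M + 1)\<^sup>2 \<le> (3 * real M)\<^sup>2"
      using assms by (intro power_mono) auto
    show "8 * r \<le> 8 * (16 * 4 * M * \<rho>)"
      unfolding r_def using assms pi_less_4 by (auto intro!: mult_right_mono)
  qed (use r in auto)
  also have "\<dots> = 4608 * real M ^ 3 * \<rho>"
    by (simp add: power2_eq_square power3_eq_cube)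
  finally show ?thesis .
qed

text \<open>If |phi x| is small, \<open>\<tau>\<close> times the projections is near integers i and
  j. Then j \<open>dir \<theta> 0\<close> - i \<open>dir \<theta> 1\<close> is small, which forces
  \<open>\<theta>\<close> close to a zero of the sine attached to the lattice point
  \<open>slope i j\<close>.\<close>

lemma cmod_\<phi>_ge_off_exceptional:
  fixes x :: real
  assumes \<theta>: "0 \<le> \<theta>" "\<theta> \<le> pi" "\<theta> \<notin> exceptional M \<rho>"
    and \<rho>: "0 < \<rho>" "\<rho> \<le> 1 / 100" and x: "0 \<le> x" "x \<le> M"
  shows "\<rho> \<le> cmod (dir.\<phi> \<theta> x)"
proof (rule ccontr)
  assume "\<not> \<rho> \<le> cmod (dir.\<phi> \<theta> x)"
  then have small: "cmod (dir.\<phi> \<theta> x) \<le> \<rho>" by simp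
  define \<tau> where "\<tau> = 3 * x / (2 * pi)"
  define i where "i = round (\<tau> * dir \<theta> 0)"
  define j where "j = round (\<tau> * dir \<theta> 1)"
  have x1: "1 < x"
    using dir.cmod_\<phi>_ge[of x \<theta>] small \<rho> x by (cases "x \<le> 1") auto
  then have M1: "1 \<le> real M" using x by linarith
  have \<tau>: "3 / 8 \<le> \<tau>" "\<tau> \<le> M / 2"
  proof -
    have "3 / 8 * (2 * pi) \<le> 3 * x" using pi_less_4 x1 by linarith
    then show "3 / 8 \<le> \<tau>" by (simp add: \<tau>_def pos_le_divide_eq)
    have "pi \<ge> 3" using pi_approx by simp
    then have "3 * x \<le> pi * M" using x by (intro mult_mono) auto
    then show "\<tau> \<le> M / 2" by (simp add: \<tau>_def pos_divide_le_eq mult_ac)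
  qed
  have close: "\<bar>\<tau> * dir \<theta> 0 - i\<bar> \<le> 3 * \<rho>" "\<bar>\<tau> * dir \<theta> 1 - j\<bar> \<le> 3 * \<rho>"
    using dir.near_integer_of_small_\<phi>[OF small, of 0] dir.near_integer_of_small_\<phi>[OF small, of 1]
    by (simp_all add: \<tau>_def i_def j_def digits_def)
  have d1: "\<bar>dir \<theta> 0\<bar> \<le> 1" "\<bar>dir \<theta> 1\<bar> \<le> 1" by (simp_all add: dir_def)
  have bound: "\<bar>n\<bar> \<le> int M" if "\<bar>\<tau> * u - of_int n\<bar> \<le> 3 * \<rho>" "\<bar>u\<bar> \<le> 1" for n u
  proof -
    have "\<bar>\<tau> * u\<bar> \<le> M / 2 * 1"
      unfolding abs_mult using that(2) \<tau> by (intro mult_mono) auto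
    then have "\<bar>real_of_int n\<bar> \<le> real M" using that(1) \<rho> M1 by linarith
    then show ?thesis by linarith
  qed
  have ij: "\<bar>i\<bar> \<le> int M" "\<bar>j\<bar> \<le> int M"
    using bound close d1 by blast+
  \<comment> \<open>Otherwise both projections u, v would be at most 1/10 in modulus, but u^2 + uv +
    v^2 = 3/4 in every direction.\<close>
  have nz: "(i, j) \<noteq> (0, 0)"
  proof
    assume "(i, j) = (0, 0)"
    then have "\<tau> * \<bar>dir \<theta> 0\<bar> \<le> 3 / 100" "\<tau> * \<bar>dir \<theta> 1\<bar> \<le> 3 / 100"
      using close \<rho> \<tau> by (simp_all add: abs_mult)
    moreover have "3 / 8 * \<bar>dir \<theta> 0\<bar> \<le> \<tau> * \<bar>dir \<theta> 0\<bar>" "3 / 8 * \<bar>dir \<theta> 1\<bar> \<le> \<tau> * \<bar>dir \<theta> 1\<bar>"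
      using \<tau> by (intro mult_right_mono; simp)+
    ultimately have s: "\<bar>dir \<theta> 0\<bar> \<le> 1 / 10" "\<bar>dir \<theta> 1\<bar> \<le> 1 / 10" by linarith+
    have "sin \<theta> * sin \<theta> = 1 - cos \<theta> * cos \<theta>"
      using sin_cos_squared_add[of \<theta>] by (simp add: power2_eq_square)
    then have "3 / 4 = 3 / 4 * (cos \<theta> * cos \<theta>) + 3 / 4 * (sin \<theta> * sin \<theta>)" by linarith
    also have "\<dots> = dir \<theta> 0 * dir \<theta> 0 + dir \<theta> 0 * dir \<theta> 1 + dir \<theta> 1 * dir \<theta> 1"
      by (simp add: dir_0 dir_1 algebra_simps)
    also have "\<dots> \<le> \<bar>dir \<theta> 0\<bar> * \<bar>dir \<theta> 0\<bar> + \<bar>dir \<theta> 0\<bar> * \<bar>dir \<theta> 1\<bar> + \<bar>dir \<theta> 1\<bar> * \<bar>dir \<theta> 1\<bar>"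
      by (simp flip: abs_mult)
    also have "\<dots> \<le> 1 / 10 * (1 / 10) + 1 / 10 * (1 / 10) + 1 / 10 * (1 / 10)"
      using s by (intro add_mono mult_mono) auto
    finally show False by simp
  qed
  \<comment> \<open>The cross product cancels the integer parts, leaving only the two rounding
    errors.\<close>
  have "\<tau> * (j * dir \<theta> 0 - i * dir \<theta> 1) = j * (\<tau> * dir \<theta> 0 - i) - i * (\<tau> * dir \<theta> 1 - j)"
    by (simp add: algebra_simps)
  then have "\<bar>\<tau> * (j * dir \<theta> 0 - i * dir \<theta> 1)\<bar> \<le> \<bar>j * (\<tau> * dir \<theta> 0 - i)\<bar> + \<bar>i * (\<tau> * dir \<theta> 1 - j)\<bar>"
    by (simp only: abs_triangle_ineq4)
  also have "\<dots> \<le> M * (3 * \<rho>) + M * (3 * \<rho>)"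
  proof -
    have "\<bar>real_of_int i\<bar> \<le> real M" "\<bar>real_of_int j\<bar> \<le> real M" using ij by linarith+
    then show ?thesis unfolding abs_mult using close by (intro add_mono mult_mono) auto
  qed
  finally have "3 / 8 * \<bar>j * dir \<theta> 0 - i * dir \<theta> 1\<bar> \<le> 6 * M * \<rho>"
    using \<tau> mult_right_mono[of "3/8" \<tau> "\<bar>j * dir \<theta> 0 - i * dir \<theta> 1\<bar>"] by (simp add: abs_mult)
  then have "cmod (slope i j) * \<bar>sin (\<theta> + Arg (slope i j))\<bar> \<le> 16 * M * \<rho>"
    by (simp add: slope_sin abs_mult mult_ac)
  moreover have "1 * \<bar>sin (\<theta> + Arg (slope i j))\<bar> \<le> cmod (slope i j) * \<bar>sin (\<theta> + Arg (slope i j))\<bar>"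
    using cmod_slope_ge[OF nz] by (intro mult_right_mono) auto
  ultimately have s: "\<bar>sin (\<theta> + Arg (slope i j))\<bar> \<le> 16 * M * \<rho>" by linarith
  define t where "t = (\<theta> + Arg (slope i j)) / pi"
  have pt: "pi * t = \<theta> + Arg (slope i j)" by (simp add: t_def)
  have "\<bar>t - of_int (round t)\<bar> \<le> 16 * M * \<rho>" using abs_sin_ge_round[of t] s by (simp add: pt)
  then have "pi * \<bar>t - of_int (round t)\<bar> \<le> pi * (16 * M * \<rho>)" by (intro mult_left_mono) auto
  moreover have "pi * \<bar>t - of_int (round t)\<bar> = \<bar>\<theta> + Arg (slope i j) - of_int (round t) * pi\<bar>"
  proof -
    have "pi * \<bar>t - of_int (round t)\<bar> = \<bar>pi * (t - of_int (round t))\<bar>" by (simp add: abs_mult)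
    then show ?thesis by (simp only: right_diff_distrib pt mult.commute)
  qed
  ultimately have "\<theta> \<in> cball (of_int (round t) * pi - Arg (slope i j)) (16 * pi * M * \<rho>)"
    by (simp add: dist_real_def abs_minus_commute algebra_simps)
  moreover have "round t \<in> {-1..2}"
  proof -
    have "- pi < pi * t" "pi * t \<le> pi * 2" unfolding pt using Arg_bounded[of "slope i j"] \<theta> by linarith+
    then have "pi * (-1) < pi * t" "pi * t \<le> pi * 2" by simp_all
    then have "-1 < t" "t \<le> 2" by (simp_all only: mult_less_cancel_left_pos mult_le_cancel_left_pos pi_gt_zero)
    then show ?thesis using round_mono[of "of_int (-1)" t] round_mono[of t 2] by (simp only: round_of_int) simp
  qed
  ultimately have "\<theta> \<in> exceptional M \<rho>"
    using ij unfolding exceptional_def by fastforce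
  then show False using \<theta> by simp
qed

section \<open>Favard length\<close>

lemma proj_gasket_subset: "proj \<theta> ` gasket_approx n \<subseteq> dir.shadow \<theta> n"
proof
  fix t assume "t \<in> proj \<theta> ` gasket_approx n"
  then obtain z \<alpha> where t: "t = proj \<theta> z" and \<alpha>: "\<alpha> \<in> {1..n} \<rightarrow>\<^sub>E {-1, 0, 1}"
    and z: "cmod (zc n \<alpha> - z) < (1 / 3) ^ n"
    by (auto simp: gasket_approx_def dist_norm)
  define w where "w = map \<alpha> [1..<Suc n]"
  have w: "w \<in> words n"
    using \<alpha> by (auto simp: w_def words_def digits_def PiE_def Pi_def simp del: upt_Suc)
  have "dir.val \<theta> (map \<alpha> [1..<Suc k]) = proj \<theta> (zc k \<alpha>)" for k
  proof (induction k)
    case (Suc k)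
    have "dir.val \<theta> (map \<alpha> [1..<Suc (Suc k)]) = proj \<theta> (zc k \<alpha>) + (1 / 3) ^ k * (dir \<theta> (\<alpha> (Suc k)) / 3)"
      using Suc.IH by (subst upt_Suc_append) (simp_all add: dir.val_append del: upt_Suc)
    also have "\<dots> = proj \<theta> (zc (Suc k) \<alpha>)"
      by (simp add: proj_def zc_def dir_def cos_diff algebra_simps)
    finally show ?case .
  qed (simp add: proj_def zc_def)
  then have "dir.val \<theta> w = proj \<theta> (zc n \<alpha>)" by (simp only: w_def)
  moreover have "\<bar>proj \<theta> (zc n \<alpha>) - proj \<theta> z\<bar> \<le> cmod ((zc n \<alpha> - z) * cis (- \<theta>))"
    using abs_Re_le_cmod[of "(zc n \<alpha> - z) * cis (- \<theta>)"] by (simp add: proj_def left_diff_distrib)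
  ultimately have "\<bar>dir.val \<theta> w - t\<bar> < (1 / 3) ^ n"
    using z by (simp add: t norm_mult)
  then show "t \<in> dir.shadow \<theta> n"
    using w by (auto simp: dir.shadow_def dist_real_def)
qed

text \<open>A bound at one depth serves all larger \<open>n\<close>, since shadows decrease. A
  non-measurable set would have measure 0 by convention, which settles the second case.\<close>

lemma measure_proj_gasket_le:
  assumes "k \<le> n"
  shows "measure lebesgue (proj \<theta> ` gasket_approx n) \<le> measure lebesgue (dir.shadow \<theta> k)"
proof (cases "proj \<theta> ` gasket_approx n \<in> sets lebesgue")
  case True
  then show ?thesis
    using proj_gasket_subset[of \<theta> n] dir.shadow_antimono[OF assms, of \<theta>]
    by (intro measure_mono_fmeasurable dir.shadow_lmeasurable) auto
qed (simp add: measure_notin_sets)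

text \<open>The base is 9 * 1458^2 * 4: rounds of the recursion, number of blocks, and 4^m as a
  bound for 2 m. For m < 4 the trivial bound 2 is enough.\<close>

lemma Fav_gasket_le:
  assumes n: "76527504 ^ m \<le> n"
  shows "Fav (gasket_approx n) \<le> 6000 / 3 ^ m"
proof -
  define f where "f \<theta> = measure lebesgue (proj \<theta> ` gasket_approx n)" for \<theta>
  have f2: "f \<theta> \<le> 2" for \<theta>
    using measure_proj_gasket_le[of 0 n \<theta>] measure_ball_real[of 1 0]
    by (simp add: f_def dir.shadow_def)
  have pi: "pi \<ge> 3" using pi_approx by simp
  show ?thesis
  proof (cases "4 \<le> m")
    case False
    have "integral {0..pi} f \<le> 2 * (pi - 0) + 2 * measure lebesgue ({} :: real set)"
      using f2 by (intro integral_le_off_exceptional) auto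
    then have "Fav (gasket_approx n) \<le> 2" by (simp add: Fav_def f_def[abs_def] pos_divide_le_eq)
    moreover have "(3 :: real) ^ m \<le> 3 ^ 4" using False by (intro power_increasing) auto
    then have "2 \<le> 6000 / (3 :: real) ^ m" by (simp add: pos_le_divide_eq)
    ultimately show ?thesis by linarith
  next
    case True
    \<comment> \<open>For M = 3^m and \<open>\<rho>\<close> = 81^(-m) the exceptional measure is of
      order M^3 \<open>\<rho>\<close> = 3^(-m), matching the bound off \<open>E\<close>.\<close>
    define E where "E = exceptional (3 ^ m) (1 / 81 ^ m)"
    define T :: nat where "T = 9 ^ m * (2 * 1458 ^ (2 * m) * m)"
    have "2 * m \<le> 4 ^ m"
    proof (induction m)
      case (Suc m)
      have "2 * Suc m \<le> 4 * P" if "2 * m \<le> P" "1 \<le> P" for P :: nat using that by simp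
      from this[OF Suc] show ?case by simp
    qed simp
    then have "T \<le> 9 ^ m * (1458 ^ (2 * m) * 4 ^ m)" by (simp add: T_def mult.commute mult.left_commute)
    also have "\<dots> = 76527504 ^ m" by (simp add: power_mult flip: power_mult_distrib)
    finally have T: "T \<le> n" using n by linarith
    have "(81 :: real) ^ 4 \<le> 81 ^ m" using True by (intro power_increasing) auto
    then have \<rho>: "1 / 81 ^ m \<le> (1 / 100 :: real)" by (simp add: field_simps)
    have "integral {0..pi} f \<le> 2561 / 3 ^ m * (pi - 0) + 2 * measure lebesgue E"
    proof (rule integral_le_off_exceptional)
      show "E \<in> lmeasurable" unfolding E_def by (rule exceptional_lmeasurable)
      fix \<theta> assume \<theta>: "0 \<le> \<theta>" "\<theta> \<le> pi"
      show "f \<theta> \<le> 2" by (rule f2)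
      assume "\<theta> \<notin> E"
      then have "measure lebesgue (dir.shadow \<theta> T) \<le> 2561 / 3 ^ m"
        unfolding T_def using \<theta> \<rho> True
        by (intro dir.measure_shadow_le cmod_\<phi>_ge_off_exceptional[where M = "3 ^ m"]) (auto simp: E_def)
      then show "f \<theta> \<le> 2561 / 3 ^ m"
        using measure_proj_gasket_le[OF T, of \<theta>] by (simp add: f_def)
    qed simp_all
    also have "measure lebesgue E \<le> 4608 * real (3 ^ m) ^ 3 * (1 / 81 ^ m)"
      unfolding E_def by (intro measure_exceptional_le) auto
    also have "\<dots> = 4608 / 3 ^ m"
    proof -
      have "(81 :: real) ^ m = (3 ^ m) ^ 3 * 3 ^ m" by (simp add: power3_eq_cube flip: power_mult_distrib)
      then show ?thesis by simp
    qed
    finally have "integral {0..pi} f \<le> (2561 * pi + 9216) / 3 ^ m" by (simp add: add_divide_distrib)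
    also have "\<dots> \<le> pi * 6000 / 3 ^ m" using pi by (intro divide_right_mono) auto
    finally show ?thesis by (simp add: Fav_def f_def[abs_def] pos_divide_le_eq mult_ac)
  qed
qed

theorem theorem1:
  shows "\<exists>p C :: real. p > 0 \<and> (\<forall>n::nat. n \<ge> 1 \<longrightarrow> Fav (gasket_approx n) \<le> C / real n powr p)"
proof (intro exI conjI allI impI)
  \<comment> \<open>With this exponent 76527504^p = 3. Placing \<open>n\<close> between consecutive
    powers of the base loses one factor 3, hence 18000.\<close>
  let ?p = "log 76527504 3 :: real"
  show p: "?p > 0" by simp
  fix n :: nat assume n: "n \<ge> 1"
  then obtain m where m: "76527504 ^ m \<le> n" "n < 76527504 ^ (m + 1)"
    using ex_power_ivl1[of 76527504 n] by auto
  have "real n \<le> 76527504 ^ (m + 1)" using m(2) by (metis less_imp_le of_nat_le_iff of_nat_numeral of_nat_power)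
  then have "real n powr ?p \<le> (76527504 ^ (m + 1)) powr ?p" using p by (intro powr_mono2) auto
  also have "\<dots> = (76527504 powr ?p) ^ (m + 1)"
  proof -
    have "(76527504 ^ (m + 1)) powr ?p = (76527504 powr real (m + 1)) powr ?p"
      by (subst powr_realpow) simp_all
    also have "\<dots> = (76527504 powr ?p) powr real (m + 1)"
      by (simp only: powr_powr mult.commute)
    also have "\<dots> = (76527504 powr ?p) ^ (m + 1)" by (rule powr_realpow) simp
    finally show ?thesis .
  qed
  also have "\<dots> = 3 ^ (m + 1)" by simp
  finally have "real n powr ?p \<le> 3 * 3 ^ m" by simp
  then have "6000 / 3 ^ m \<le> 18000 / real n powr ?p" using n by (simp add: field_simps)
  then show "Fav (gasket_approx n) \<le> 18000 / real n powr ?p" using Fav_gasket_le[OF m(1)] by linarith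
qed

end
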